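(* Let $r$ be a rank array that can occur. Every reduced pipe dream $D\in\mathcal{RP}(v(r))$ for the Zelevinsky permutation $v(r)$ gives rise to a minimal length lacing diagram $\mathbf w(D)$ with rank array $r$; that is, $\mathbf w(D)\in W(r)$.
   Context: Rank arrays. Let $k$ be a field, $n\ge1$, $r_0,\dots,r_n$ nonnegative integers, $d=r_0+\cdots+r_n$, $\mathit{Hom}=\prod_{i=1}^nM_{r_{i-1}\times r_i}(k)$. The rank array of $\phi\in\mathit{Hom}$ is $r_{ij}(\phi)=\operatorname{rank}(\phi_{i+1}\cdots\phi_j)$ for $i<j$, $r_{ii}(\phi)=r_i$. A rank array can occur if it is $r(\phi)$ for some $\phi\in\mathit{Hom}$. Zelevinsky permutation. Put $s_{ij}=r_{ij}-r_{i-1,j}-r_{i,j+1}+r_{i-1,j+1}$ for $0\le i\le j\le n$, where $r_{ab}=0$ unless $0\le a,b\le n$. Divide the $d\times d$ grid into block rows $0,\dots,n$ from top to bottom of heights $r_0,\dots,r_n$ and block columns labelled $n,\dots,0$ from left to right, block column $i$ having width $r_i$. The matrix of a permutation $v$ has its $1$'s at $(q,v(q))$. $v(r)\in S_d$ is the unique permutation such that the block in block column $i$ and block row $j$ contains exactly $s_{ij}$ ones if $i\le j$, $r_{j,j+1}$ ones if $i=j+1$, none if $i\ge j+2$, and such that within every block row and block column the $1$'s proceed from northwest to southeast. Pipe dreams. A pipe dream $D$ is a subset of the boxes $(q,p)$ (row $q$, column $p$) of the $d\times d$ grid, all with $q+p\le d$. Boxes in $D$ carry a crossing tile and all others an elbow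 tile (the pipe entering from the west turns north, the pipe entering from the south turns east). $D$ is reduced if every two pipes cross at most once. $\mathcal{RP}(v)$ is the set of reduced pipe dreams in which the pipe entering row $q$ from the west exits at the top of column $v(q)$, for all $q\le d$. The lacing diagram of a pipe dream. The $j$-th antidiagonal block is the $r_j\times r_j$ block in block row $j$ and block column $j$. Follow the pipes from northeast to southwest. For $D\in\mathcal{RP}(v(r))$ and $1\le j\le n$, $w_j(D)$ is the $r_{j-1}\times r_j$ partial permutation matrix with a $1$ at $(p,q)$ exactly when the pipe entering the $(j-1)$-st antidiagonal block through the top of its $p$-th column from the right enters the $j$-th antidiagonal block through the top of its $q$-th column from the right. Set $\mathbf w(D)=(w_1(D),\dots,w_n(D))$. Minimal length lacing diagrams. A partial permutation of size $a\times b$ is an $a\times b$ $0$-$1$ matrix with at most one $1$ in each row and column. Its completion $\tilde w$ is the minimal-length permutation whose matrix has $w$ as its northwest corner (in rows below $a$ and in columns right of $b$ the $1$'s proceed northwest to southeast); $\ell(w)=\ell(\tilde w)$. A lacing diagram is a list $\mathbf w=(w_1,\dots,w_n)\in\mathit{Hom}$ of partial permutations; $\ell(\mathbf w)=\sum\ell(w_i)$. With $d(r)=\sum_{0\le i<j\le n}(r_{i,j-1}-r_{ij})(r_{i+1,j}-r_{ij})$ (the codimension of the quiver locus $\Omega_r$), $W(r)$ is the set of lacing diagrams in $\mathit{Hom}$ with rank array $r$ and length $d(r)$. *)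

theory Defs
  imports
    "Jordan_Normal_Form.DL_Rank"
    "HOL-Combinatorics.Permutations"
    "HOL-Library.FuncSet"
begin

text \<open>
  Throughout, \<open>n\<close> is the number of maps and \<open>e i\<close> is the dimension \<open>r\<^sub>i\<close> for \<open>0 \<le> i \<le> n\<close>
  (some of the \<open>e i\<close> may be 0). A rank array is a function \<open>r\<close>, of which only the values
  \<open>r i j\<close> with \<open>i \<le> j \<le> n\<close> are meaningful.
\<close>

definition Hom :: "nat \<Rightarrow> (nat \<Rightarrow> nat) \<Rightarrow> (nat \<Rightarrow> 'k::field mat) set" where
  "Hom n e = (\<Pi>\<^sub>E i\<in>{1..n}. carrier_mat (e (i - 1)) (e i))"

text \<open>The product \<open>\<phi>\<^bsub>i+1\<^esub> \<cdots> \<phi>\<^bsub>j\<^esub>\<close>, of size \<open>e i \<times> e j\<close>.\<close>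

definition path_product :: "(nat \<Rightarrow> nat) \<Rightarrow> (nat \<Rightarrow> 'k::field mat) \<Rightarrow> nat \<Rightarrow> nat \<Rightarrow> 'k mat" where
  "path_product e \<phi> i j = foldr (*) (map \<phi> [Suc i..<Suc j]) (1\<^sub>m (e j))"

definition has_rank_array ::
    "nat \<Rightarrow> (nat \<Rightarrow> nat) \<Rightarrow> (nat \<Rightarrow> nat \<Rightarrow> nat) \<Rightarrow> (nat \<Rightarrow> 'k::field mat) \<Rightarrow> bool" where
  "has_rank_array n e r \<phi> \<longleftrightarrow>
     (\<forall>i\<le>n. r i i = e i) \<and>
     (\<forall>i j. i < j \<and> j \<le> n \<longrightarrow> r i j = vec_space.rank (e i) (path_product e \<phi> i j))"

definition can_occur ::
    "'k::field itself \<Rightarrow> nat \<Rightarrow> (nat \<Rightarrow> nat) \<Rightarrow> (nat \<Rightarrow> nat \<Rightarrow> nat) \<Rightarrow> bool" where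
  "can_occur _ n e r \<longleftrightarrow> (\<exists>\<phi> :: nat \<Rightarrow> 'k mat. \<phi> \<in> Hom n e \<and> has_rank_array n e r \<phi>)"


subsection \<open>The Zelevinsky permutation\<close>

text \<open>Rows and columns of the grid are numbered \<open>1, \<dots>, d\<close>. Block columns are labelled
  \<open>n, \<dots>, 0\<close> from left to right.\<close>

definition grid_size :: "nat \<Rightarrow> (nat \<Rightarrow> nat) \<Rightarrow> nat" where
  "grid_size n e = (\<Sum>i\<le>n. e i)"

definition rows_above :: "(nat \<Rightarrow> nat) \<Rightarrow> nat \<Rightarrow> nat" where
  "rows_above e j = (\<Sum>i<j. e i)"

definition cols_left :: "nat \<Rightarrow> (nat \<Rightarrow> nat) \<Rightarrow> nat \<Rightarrow> nat" where
  "cols_left n e i = (\<Sum>k\<in>{i<..n}. e k)"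

definition block_row :: "(nat \<Rightarrow> nat) \<Rightarrow> nat \<Rightarrow> nat set" where
  "block_row e j = {rows_above e j <.. rows_above e j + e j}"

definition block_col :: "nat \<Rightarrow> (nat \<Rightarrow> nat) \<Rightarrow> nat \<Rightarrow> nat set" where
  "block_col n e i = {cols_left n e i <.. cols_left n e i + e i}"

definition ext_rank :: "nat \<Rightarrow> (nat \<Rightarrow> nat \<Rightarrow> nat) \<Rightarrow> int \<Rightarrow> int \<Rightarrow> int" where
  "ext_rank n r a b =
     (if 0 \<le> a \<and> a \<le> int n \<and> 0 \<le> b \<and> b \<le> int n then int (r (nat a) (nat b)) else 0)"

definition lace_count :: "nat \<Rightarrow> (nat \<Rightarrow> nat \<Rightarrow> nat) \<Rightarrow> nat \<Rightarrow> nat \<Rightarrow> int" where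
  "lace_count n r i j =
     ext_rank n r (int i) (int j) - ext_rank n r (int i - 1) (int j)
     - ext_rank n r (int i) (int j + 1) + ext_rank n r (int i - 1) (int j + 1)"

definition is_zelevinsky_perm ::
    "nat \<Rightarrow> (nat \<Rightarrow> nat) \<Rightarrow> (nat \<Rightarrow> nat \<Rightarrow> nat) \<Rightarrow> (nat \<Rightarrow> nat) \<Rightarrow> bool" where
  "is_zelevinsky_perm n e r v \<longleftrightarrow>
     v permutes {1..grid_size n e} \<and>
     (\<forall>i\<le>n. \<forall>j\<le>n.
        int (card {q \<in> block_row e j. v q \<in> block_col n e i}) =
          (if i \<le> j then lace_count n r i j
           else if i = j + 1 then int (r j (j + 1))
           else 0)) \<and>
     (\<forall>j\<le>n. strict_mono_on (block_row e j) v) \<and>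
     (\<forall>i\<le>n. strict_mono_on (block_col n e i) (inv_into UNIV v))"

definition zelevinsky_perm ::
    "nat \<Rightarrow> (nat \<Rightarrow> nat) \<Rightarrow> (nat \<Rightarrow> nat \<Rightarrow> nat) \<Rightarrow> nat \<Rightarrow> nat" where
  "zelevinsky_perm n e r = (THE v. is_zelevinsky_perm n e r v)"


subsection \<open>Pipe dreams\<close>

definition pipe_dreams :: "nat \<Rightarrow> (nat \<times> nat) set set" where
  "pipe_dreams d = Pow {(q, p). 1 \<le> q \<and> 1 \<le> p \<and> q + p \<le> d}"

text \<open>
  Unit edges of the grid: \<open>Vert q p\<close> is the east edge of box \<open>(q, p)\<close> and the west edge of
  box \<open>(q, p + 1)\<close>; \<open>Horiz q p\<close> is the south edge of box \<open>(q, p)\<close> and the north edge of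
  box \<open>(q + 1, p)\<close>. So \<open>Vert q 0\<close> lies on the west border and \<open>Horiz 0 p\<close> on the top border.
\<close>

datatype grid_edge = Vert nat nat | Horiz nat nat

text \<open>The set of edges met by the pipe that enters row \<open>x\<close> from the west.\<close>

inductive_set pipe :: "(nat \<times> nat) set \<Rightarrow> nat \<Rightarrow> grid_edge set"
  for D :: "(nat \<times> nat) set" and x :: nat where
  start: "Vert x 0 \<in> pipe D x"
| cross_west: "Vert (Suc q) p \<in> pipe D x \<Longrightarrow> (Suc q, Suc p) \<in> D
    \<Longrightarrow> Vert (Suc q) (Suc p) \<in> pipe D x"
| elbow_west: "Vert (Suc q) p \<in> pipe D x \<Longrightarrow> (Suc q, Suc p) \<notin> D
    \<Longrightarrow> Horiz q (Suc p) \<in> pipe D x"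
| cross_south: "Horiz (Suc q) (Suc p) \<in> pipe D x \<Longrightarrow> (Suc q, Suc p) \<in> D
    \<Longrightarrow> Horiz q (Suc p) \<in> pipe D x"
| elbow_south: "Horiz (Suc q) (Suc p) \<in> pipe D x \<Longrightarrow> (Suc q, Suc p) \<notin> D
    \<Longrightarrow> Vert (Suc q) (Suc p) \<in> pipe D x"

text \<open>The crossing tiles that pipe \<open>x\<close> traverses horizontally and pipe \<open>y\<close> vertically.\<close>

definition crossings :: "(nat \<times> nat) set \<Rightarrow> nat \<Rightarrow> nat \<Rightarrow> (nat \<times> nat) set" where
  "crossings D x y = {(q, p) \<in> D. Vert q (p - 1) \<in> pipe D x \<and> Horiz q p \<in> pipe D y}"

definition reduced :: "nat \<Rightarrow> (nat \<times> nat) set \<Rightarrow> bool" where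
  "reduced d D \<longleftrightarrow>
     (\<forall>x\<in>{1..d}. \<forall>y\<in>{1..d}. x \<noteq> y \<longrightarrow> card (crossings D x y \<union> crossings D y x) \<le> 1)"

definition RP :: "nat \<Rightarrow> (nat \<Rightarrow> nat) \<Rightarrow> (nat \<times> nat) set set" where
  "RP d v = {D \<in> pipe_dreams d. reduced d D \<and> (\<forall>q\<in>{1..d}. Horiz 0 (v q) \<in> pipe D q)}"


subsection \<open>The lacing diagram of a pipe dream\<close>

text \<open>
  The top edge of a column of the \<open>j\<close>-th antidiagonal block. Matrix indices start at 0, so
  \<open>p = 0\<close> denotes the rightmost column of the block, and \<open>p < e j\<close>.
\<close>

definition block_top :: "nat \<Rightarrow> (nat \<Rightarrow> nat) \<Rightarrow> nat \<Rightarrow> nat \<Rightarrow> grid_edge" where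
  "block_top n e j p = Horiz (rows_above e j) (cols_left n e j + e j - p)"

text \<open>
  Followed from northeast to southwest, a pipe never goes back up, so it meets the top of the
  block \<open>j - 1\<close> before that of block \<open>j\<close>; it suffices to say that both edges lie on it.
\<close>

definition lacing_of ::
    "nat \<Rightarrow> (nat \<Rightarrow> nat) \<Rightarrow> (nat \<times> nat) set \<Rightarrow> nat \<Rightarrow> 'k::field mat" where
  "lacing_of n e D = (\<lambda>j\<in>{1..n}. mat (e (j - 1)) (e j) (\<lambda>(p, q).
     if \<exists>x\<in>{1..grid_size n e}. block_top n e (j - 1) p \<in> pipe D x \<and> block_top n e j q \<in> pipe D x
     then 1 else 0))"


subsection \<open>Minimal length lacing diagrams\<close>

definition partial_perm :: "'k::field mat \<Rightarrow> bool" where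
  "partial_perm w \<longleftrightarrow>
     (\<forall>i<dim_row w. \<forall>j<dim_col w. w $$ (i, j) \<in> {0, 1}) \<and>
     (\<forall>i<dim_row w. card {j. j < dim_col w \<and> w $$ (i, j) = 1} \<le> 1) \<and>
     (\<forall>j<dim_col w. card {i. i < dim_row w \<and> w $$ (i, j) = 1} \<le> 1)"

definition perm_length :: "(nat \<Rightarrow> nat) \<Rightarrow> nat" where
  "perm_length \<sigma> = card {(i, j). i < j \<and> \<sigma> j < \<sigma> i}"

text \<open>Permutations of any finite size, extended by the identity, that have \<open>w\<close> as their
  northwest corner; rows and columns start at 0 here.\<close>

definition extends_perm :: "'k::field mat \<Rightarrow> (nat \<Rightarrow> nat) \<Rightarrow> bool" where
  "extends_perm w \<sigma> \<longleftrightarrow>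
     (\<exists>m. \<sigma> permutes {..<m}) \<and>
     (\<forall>i<dim_row w. \<forall>j<dim_col w. \<sigma> i = j \<longleftrightarrow> w $$ (i, j) = 1)"

definition completion :: "'k::field mat \<Rightarrow> nat \<Rightarrow> nat" where
  "completion w = (ARG_MIN perm_length \<sigma>. extends_perm w \<sigma>)"

definition lacing_diagrams :: "nat \<Rightarrow> (nat \<Rightarrow> nat) \<Rightarrow> (nat \<Rightarrow> 'k::field mat) set" where
  "lacing_diagrams n e = {w \<in> Hom n e. \<forall>i\<in>{1..n}. partial_perm (w i)}"

definition lacing_length :: "nat \<Rightarrow> (nat \<Rightarrow> 'k::field mat) \<Rightarrow> nat" where
  "lacing_length n w = (\<Sum>i\<in>{1..n}. perm_length (completion (w i)))"

definition quiver_codim :: "nat \<Rightarrow> (nat \<Rightarrow> nat \<Rightarrow> nat) \<Rightarrow> int" where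
  "quiver_codim n r =
     (\<Sum>(i, j)\<in>{(i, j). i < j \<and> j \<le> n}.
        (int (r i (j - 1)) - int (r i j)) * (int (r (i + 1) j) - int (r i j)))"

definition W :: "nat \<Rightarrow> (nat \<Rightarrow> nat) \<Rightarrow> (nat \<Rightarrow> nat \<Rightarrow> nat) \<Rightarrow> (nat \<Rightarrow> 'k::field mat) set" where
  "W n e r = {w \<in> lacing_diagrams n e.
     has_rank_array n e r w \<and> int (lacing_length n w) = quiver_codim n r}"

end

theory Submission
  imports Defs
begin

text \<open>
  Reading all pipes diagonal by diagonal, two pipes change their relative order exactly at their
  crossings, so in a reduced pipe dream they do so at most once. Since \<open>v(r)\<close> has no ones in
  the blocks strictly northwest of the block superantidiagonal, all boxes there are crossings;
  hence the pipe \<open>x\<close> that starts in block row \<open>l\<close> and exits in block column \<open>k\<close> enters exactly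
  the antidiagonal blocks \<open>k, \<dots>, l\<close> through their tops, and the number of pipes that enter both
  block \<open>i\<close> and block \<open>j\<close> telescopes to \<open>r i j\<close>. This gives the rank array.

  The length of a partial permutation is the size of its Rothe diagram, and a diagram box of the
  \<open>j\<close>-th partial permutation is a pair of pipes \<open>(x, y)\<close> that change their order between the tops
  of the blocks \<open>j\<close> and \<open>j - 1\<close>; no order is required at a top that one of them does not meet.
  By reducedness each pair is counted for exactly one \<open>j\<close> if its laces \<open>[k, l]\<close> and \<open>[k', l']\<close> satisfy
  \<open>k < k' \<le> l + 1 \<le> l'\<close>, and never otherwise. The number of such pairs is the codimension \<open>d(r)\<close>.
\<close>

section \<open>Ranks\<close>

text \<open>Block tops are horizontal, and two pipes in general meet the same horizontal line at
  different moments, whereas a change of order is visible only when the pipes are compared at the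
  same moment along a diagonal. This mismatch shapes the part on pipes: an order on a horizontal
  line persists as an order of positions at every time between the two arrivals, so orders on
  different lines can be compared on a common clock. \<open>zelevinsky_perm\<close> is a definite
  description, so its properties become available only after existence and uniqueness. Existence
  requires every \<open>lace_count\<close> to be nonnegative, and for the ranks of actual matrix
  products this is the Frobenius rank inequality together with its one-sided boundary cases.\<close>

lemma (in vec_space) rank_le_card_spanning:
  assumes M: "M \<in> carrier_mat n nc" and S: "finite S" "S \<subseteq> carrier_vec n"
    and sub: "set (cols M) \<subseteq> span S"
  shows "rank M \<le> card S"
proof -
  have fin: "finite (set (cols M))" by simp
  have C: "set (cols M) \<subseteq> carrier_vec n" using M cols_dim by blast
  have "lin_indpt {}" by (metis empty_subsetI fin_dim finite_basis_exists subset_li_is_li vec_vs vectorspace.basis_def)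
  then obtain U where U: "maximal U (\<lambda>T. T \<subseteq> set (cols M) \<and> lin_indpt T)" "finite U"
    using maximal_exists_superset[OF fin, of "\<lambda>T. T \<subseteq> set (cols M) \<and> lin_indpt T" "{}"] by auto
  have "U \<subseteq> set (cols M)" "lin_indpt U" using U(1) by (auto simp: maximal_def)
  moreover from this have "U \<subseteq> span S" using sub by blast
  \<comment> \<open>Steinitz exchange: the independent set \<open>U\<close> lies in the span of
    \<open>S\<close>, so its size is at most that of \<open>S\<close>. As a maximal independent set
    of columns, \<open>U\<close> has the rank as its size.\<close>
  ultimately have "\<exists>C. finite C \<and> C\<subseteq>carrier V \<and> C\<subseteq>span S \<and> C\<inter>U={} \<and>
      int (card C) \<le> (int (card S)) - (int (card U)) \<and> (span (U \<union> C) = span S)"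
    using replacement[OF U(2) S(1)] S(2) by simp
  then have "card U \<le> card S" by force
  then show ?thesis using rank_card_indpt[OF M U(1)] by simp
qed

lemma (in vec_space) rank_basis_of_cols:
  assumes M: "M \<in> carrier_mat n nc"
  obtains S where "finite S" "S \<subseteq> set (cols M)" "lin_indpt S" "card S = rank M"
    "set (cols M) \<subseteq> span S"
proof -
  have fin: "finite (set (cols M))" by simp
  have C: "set (cols M) \<subseteq> carrier_vec n" using M cols_dim by blast
  have "lin_indpt {}" by (metis empty_subsetI fin_dim finite_basis_exists subset_li_is_li vec_vs vectorspace.basis_def)
  then obtain U where U: "maximal U (\<lambda>T. T \<subseteq> set (cols M) \<and> lin_indpt T)" "finite U"
    using maximal_exists_superset[OF fin, of "\<lambda>T. T \<subseteq> set (cols M) \<and> lin_indpt T" "{}"] by auto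
  have sub: "U \<subseteq> set (cols M)" and li: "lin_indpt U" using U(1) by (auto simp: maximal_def)
  have UC: "U \<subseteq> carrier_vec n" using sub C by blast
  have "set (cols M) \<subseteq> span U"
  proof
    fix s assume s: "s \<in> set (cols M)"
    show "s \<in> span U"
    proof (rule ccontr)
      assume ns: "s \<notin> span U"
      moreover from this have "s \<notin> U" using span_mem UC by auto
      ultimately have "lin_indpt (U \<union> {s})"
        using lin_dep_iff_in_span[of U s] li UC C s by auto
      moreover have "U \<union> {s} \<subseteq> set (cols M)" using s sub by auto
      ultimately have "U = U \<union> {s}" using U(1) unfolding maximal_def by blast
      then show False using ns span_mem[OF _, of U s] UC by auto
    qed
  qed
  then show ?thesis using that U(2) sub li rank_card_indpt[OF M U(1)] by simp
qed

text \<open>The spans are written out in full because the statement, made outside any locale,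
  involves two vector spaces, of dimensions \<open>n\<close> and \<open>m\<close>, at once.\<close>

lemma mult_mat_vec_in_span:
  fixes A :: "'k::field mat"
  assumes A: "A \<in> carrier_mat m n" and S: "S \<subseteq> carrier_vec n"
    and X: "X \<subseteq> carrier_vec m"
    and sub: "\<And>s. s \<in> S \<Longrightarrow> A *\<^sub>v s \<in> LinearCombinations.module.span class_ring (module_vec TYPE('k) m) X"
    and v: "v \<in> LinearCombinations.module.span class_ring (module_vec TYPE('k) n) S"
  shows "A *\<^sub>v v \<in> LinearCombinations.module.span class_ring (module_vec TYPE('k) m) X"
proof -
  interpret N: vec_space "TYPE('k)" n .
  interpret M: vec_space "TYPE('k)" m .
  obtain a T where v: "v = N.lincomb a T" and T: "finite T" "T \<subseteq> S"
    using N.in_spanE[OF v] by blast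
  have "A *\<^sub>v N.lincomb a T \<in> M.span X" using T
  proof (induction T rule: finite_induct)
    case empty
    have "A *\<^sub>v 0\<^sub>v n = 0\<^sub>v m" using A by auto
    then show ?case using vectorspace.span_zero[OF M.vectorspace_axioms, of X] by (simp add: N.lincomb_def)
  next
    case (insert s T)
    have s: "s \<in> carrier_vec n" "T \<subseteq> carrier_vec n" using insert S by auto
    have l: "N.lincomb a T \<in> carrier_vec n" using N.lincomb_closed[OF s(2)] by auto
    have "N.lincomb a (insert s T) = a s \<cdot>\<^sub>v s + N.lincomb a T"
      using N.lincomb_insert2[OF insert(1) s(2) _ insert(2) s(1), of a] by auto
    then have "A *\<^sub>v N.lincomb a (insert s T) = A *\<^sub>v (a s \<cdot>\<^sub>v s) + A *\<^sub>v N.lincomb a T"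
      using mult_add_distrib_mat_vec[OF A _ l, of "a s \<cdot>\<^sub>v s"] s by simp
    also have "A *\<^sub>v (a s \<cdot>\<^sub>v s) = a s \<cdot>\<^sub>v (A *\<^sub>v s)" using mult_mat_vec[OF A s(1)] by simp
    finally have eq: "A *\<^sub>v N.lincomb a (insert s T) = a s \<cdot>\<^sub>v (A *\<^sub>v s) + A *\<^sub>v N.lincomb a T" .
    have "a s \<cdot>\<^sub>v (A *\<^sub>v s) \<in> M.span X" using M.smult_in_span[OF X sub] insert by auto
    then show ?case unfolding eq using M.span_add1[OF X] insert by auto
  qed
  then show ?thesis using v by simp
qed

lemma set_cols_mult: "set (cols (A * B)) = (\<lambda>v. A *\<^sub>v v) ` set (cols B)"
  if "A \<in> carrier_mat n m" "B \<in> carrier_mat m p"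
proof -
  have "cols (A * B) = map (\<lambda>v. A *\<^sub>v v) (cols B)"
    using that by (intro nth_equalityI) (auto simp: col_mult2)
  then show ?thesis by simp
qed

lemma mult_mat_vec_in_span_cols:
  fixes A :: "'k::field mat"
  assumes "A \<in> carrier_mat n nc" "v \<in> carrier_vec nc"
  shows "A *\<^sub>v v \<in> LinearCombinations.module.span class_ring (module_vec TYPE('k) n) (set (cols A))"
proof -
  interpret N: vec_space "TYPE('k)" n .
  interpret M: vec_space "TYPE('k)" nc .
  have C: "set (cols A) \<subseteq> carrier_vec n" using assms cols_dim by blast
  have "A *\<^sub>v s \<in> N.span (set (cols A))" if s: "s \<in> set (unit_vecs nc)" for s
  proof -
    obtain i where i: "i < nc" "s = unit_vec nc i" using s by (auto simp: unit_vecs_def)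
    have "A *\<^sub>v s = col A i" using assms i by (intro eq_vecI) (auto simp: scalar_prod_right_unit)
    then show ?thesis using N.span_mem[OF C] assms i by (auto simp: in_set_conv_nth intro: exI[of _ i] simp: cols_def)
  qed
  then show ?thesis
    using mult_mat_vec_in_span[OF assms(1) unit_vecs_carrier C] assms(2) M.span_unit_vecs_is_carrier by blast
qed

lemma rank_mult_left_le:
  fixes A :: "'k::field mat"
  assumes A: "A \<in> carrier_mat n m" and B: "B \<in> carrier_mat m p"
  shows "vec_space.rank n (A * B) \<le> vec_space.rank n A"
proof -
  interpret N: vec_space "TYPE('k)" n .
  have AC: "set (cols A) \<subseteq> carrier_vec n" using A cols_dim by blast
  obtain S where S: "finite S" "S \<subseteq> set (cols A)" "card S = N.rank A" "set (cols A) \<subseteq> N.span S"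
    using N.rank_basis_of_cols[OF A] by metis
  have SC: "S \<subseteq> carrier_vec n" using S AC by blast
  have "A *\<^sub>v v \<in> N.span S" if "v \<in> carrier_vec m" for v
    using mult_mat_vec_in_span_cols[OF A that] N.span_subsetI[OF SC S(4)] by blast
  then have "set (cols (A * B)) \<subseteq> N.span S"
    unfolding set_cols_mult[OF A B] using B cols_dim by blast
  then show ?thesis using N.rank_le_card_spanning[of "A * B" p S] A B S SC by simp
qed

text \<open>With \<open>S0\<close> a basis of the column space of \<open>B * C\<close>, extended by \<open>E\<close> to one of \<open>B\<close>,
  the column space of \<open>A * B\<close> is spanned by that of \<open>A * B * C\<close> and \<open>A * E\<close>.\<close>

lemma rank_frobenius:
  fixes A :: "'k::field mat"
  assumes A: "A \<in> carrier_mat a b" and B: "B \<in> carrier_mat b c" and C: "C \<in> carrier_mat c e"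
  shows "vec_space.rank a (A * B) + vec_space.rank b (B * C)
    \<le> vec_space.rank b B + vec_space.rank a (A * (B * C))"
proof -
  interpret N: vec_space "TYPE('k)" a .
  interpret M: vec_space "TYPE('k)" b .
  have BC: "B * C \<in> carrier_mat b e" and ABC: "A * (B * C) \<in> carrier_mat a e"
    and AB: "A * B \<in> carrier_mat a c" using A B C by auto
  have car: "set (cols B) \<subseteq> carrier_vec b" "set (cols (B * C)) \<subseteq> carrier_vec b"
    "set (cols (A * (B * C))) \<subseteq> carrier_vec a"
    using cols_dim B BC ABC by blast+
  obtain S0 where S0: "finite S0" "S0 \<subseteq> set (cols (B * C))" "M.lin_indpt S0"
      "card S0 = M.rank (B * C)" "set (cols (B * C)) \<subseteq> M.span S0"
    using M.rank_basis_of_cols[OF BC] .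
  obtain S1 where S1: "finite S1" "S1 \<subseteq> set (cols B)" "card S1 = M.rank B"
      "set (cols B) \<subseteq> M.span S1"
    using M.rank_basis_of_cols[OF B] by metis
  obtain S2 where S2: "finite S2" "S2 \<subseteq> set (cols (A * (B * C)))"
      "card S2 = N.rank (A * (B * C))" "set (cols (A * (B * C))) \<subseteq> N.span S2"
    using N.rank_basis_of_cols[OF ABC] by metis
  have S1C: "S1 \<subseteq> carrier_vec b" and S2C: "S2 \<subseteq> carrier_vec a" and S0C: "S0 \<subseteq> carrier_vec b"
    using S0 S1 S2 car by auto
  have "set (cols (B * C)) \<subseteq> M.span (set (cols B))"
    unfolding set_cols_mult[OF B C] using mult_mat_vec_in_span_cols[OF B] C cols_dim by blast
  then have "S0 \<subseteq> M.span S1" using S0(2) M.span_subsetI[OF S1C S1(4)] by blast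
  \<comment> \<open>The bound on \<open>card E\<close> is where the defect
    \<open>rank B - rank (B * C)\<close> of the inequality arises: at most that many vectors have to
    be added to a basis of the smaller column space.\<close>
  then obtain E where E: "finite E" "E \<subseteq> carrier_vec b"
      "int (card E) \<le> int (card S1) - int (card S0)" "M.span (S0 \<union> E) = M.span S1"
    using M.replacement[OF S0(1) S1(1) _ S0(3)] S1C by auto
  define X where "X = S2 \<union> (\<lambda>v. A *\<^sub>v v) ` E"
  have X: "finite X" "X \<subseteq> carrier_vec a" using S2 E S2C A by (auto simp: X_def)
  have "set (cols (A * B)) \<subseteq> N.span X"
    unfolding set_cols_mult[OF A B]
  proof clarify
    fix v assume "v \<in> set (cols B)"
    then have v: "v \<in> M.span (S0 \<union> E)" using S1 E by auto
    show "A *\<^sub>v v \<in> N.span X"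
    proof (rule mult_mat_vec_in_span[OF A _ X(2) _ v])
      show "S0 \<union> E \<subseteq> carrier_vec b" using S0C E by auto
      fix s assume "s \<in> S0 \<union> E"
      then show "A *\<^sub>v s \<in> N.span X"
      proof
        assume "s \<in> S0"
        then have "A *\<^sub>v s \<in> set (cols (A * (B * C)))"
          unfolding set_cols_mult[OF A BC] using S0(2) by blast
        then show ?thesis using S2(4) N.span_is_monotone[of S2 X] by (auto simp: X_def)
      next
        assume "s \<in> E"
        then show ?thesis using N.span_mem[OF X(2)] by (auto simp: X_def)
      qed
    qed
  qed
  then have "N.rank (A * B) \<le> card X" using N.rank_le_card_spanning[OF AB X] by blast
  also have "\<dots> \<le> card S2 + card E"
    unfolding X_def using card_Un_le[of S2] card_image_le[OF E(1)] by (meson add_left_mono order_trans)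
  finally show ?thesis using S0(4) S1(3) S2(3) E(3) by linarith
qed

lemma rank_mult_right_le:
  fixes A :: "'k::field mat"
  assumes A: "A \<in> carrier_mat n m" and B: "B \<in> carrier_mat m p"
  shows "vec_space.rank n (A * B) \<le> vec_space.rank m B"
proof -
  interpret N: vec_space "TYPE('k)" n .
  interpret M: vec_space "TYPE('k)" m .
  have BC: "set (cols B) \<subseteq> carrier_vec m" using B cols_dim by blast
  obtain S where S: "finite S" "S \<subseteq> set (cols B)" "card S = M.rank B" "set (cols B) \<subseteq> M.span S"
    using M.rank_basis_of_cols[OF B] by metis
  have SC: "S \<subseteq> carrier_vec m" using S BC by blast
  have X: "(\<lambda>v. A *\<^sub>v v) ` S \<subseteq> carrier_vec n" using A SC by auto
  have "set (cols (A * B)) \<subseteq> N.span ((\<lambda>v. A *\<^sub>v v) ` S)"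
    unfolding set_cols_mult[OF A B]
    using mult_mat_vec_in_span[OF A SC X] N.span_mem[OF X] S(4) by blast
  then have "N.rank (A * B) \<le> card ((\<lambda>v. A *\<^sub>v v) ` S)"
    using N.rank_le_card_spanning[of "A * B" p] A B S X by simp
  also have "\<dots> \<le> card S" using card_image_le[OF S(1)] .
  finally show ?thesis using S by simp
qed

lemma rank_one_mat: "vec_space.rank n (1\<^sub>m n :: 'k::field mat) = n"
proof -
  interpret N: vec_space "TYPE('k)" n .
  have c: "cols (1\<^sub>m n :: 'k mat) = unit_vecs n" by (simp add: cols_def unit_vecs_def cong: map_cong)
  show ?thesis
    using N.lin_indpt_full_rank[of "1\<^sub>m n" n] N.unit_vecs_basis N.unit_vecs_distinct
    unfolding c N.basis_def by simp
qed

text \<open>Every column is zero or a unit vector, by injectivity of \<open>snd\<close>, and the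
  unit vectors are distinct, by injectivity of \<open>fst\<close>. They form a maximal independent
  set of columns with one element for each one of the matrix.\<close>

lemma rank_partial_permutation:
  fixes X :: "(nat \<times> nat) set"
  assumes X: "X \<subseteq> {..<a} \<times> {..<b}" and f: "inj_on fst X" and s: "inj_on snd X"
  shows "vec_space.rank a (mat a b (\<lambda>z. if z \<in> X then 1 else 0 :: 'k::field)) = card X"
proof -
  interpret N: vec_space "TYPE('k)" a .
  let ?M = "mat a b (\<lambda>z. if z \<in> X then 1 else 0 :: 'k)"
  define S where "S = (\<lambda>z. unit_vec a (fst z) :: 'k vec) ` X"
  have uinj: "i = j" if "unit_vec a i = (unit_vec a j :: 'k vec)" "i < a" "j < a" for i j
  proof -
    have "unit_vec a i $ i = (unit_vec a j :: 'k vec) $ i" using that(1) by simp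
    then show ?thesis using that(2,3) by (auto split: if_splits)
  qed
  have "inj_on (\<lambda>z. unit_vec a (fst z) :: 'k vec) X"
    using f X uinj unfolding inj_on_def by fastforce
  then have cS: "card S = card X" unfolding S_def by (rule card_image)
  have colX: "col ?M j = unit_vec a i" if "(i, j) \<in> X" for i j
  proof (rule eq_vecI)
    fix k assume k: "k < dim_vec (unit_vec a i :: 'k vec)"
    have "(k, j) \<in> X \<longleftrightarrow> k = i" using that s unfolding inj_on_def by fastforce
    then show "col ?M j $ k = unit_vec a i $ k" using k that X by auto
  qed (use that X in auto)
  have SM: "S \<subseteq> set (cols ?M)"
  proof
    fix v assume "v \<in> S"
    then obtain i j where "(i, j) \<in> X" "v = unit_vec a i" by (auto simp: S_def)
    then have "v = col ?M j" "j < b" using colX X by auto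
    then show "v \<in> set (cols ?M)" by (auto simp: cols_def)
  qed
  have Su: "S \<subseteq> set (unit_vecs a)" using X by (auto simp: S_def unit_vecs_def)
  have li: "N.lin_indpt S"
    using N.unit_vecs_basis Su N.subset_li_is_li unfolding N.basis_def by blast
  have "S = T" if T: "S \<subseteq> T" "T \<subseteq> set (cols ?M)" "N.lin_indpt T" for T
  proof (rule ccontr)
    assume "S \<noteq> T"
    then obtain v where v: "v \<in> T" "v \<notin> S" using T by auto
    then obtain j where j: "j < b" "v = col ?M j" using T by (auto simp: cols_def)
    have "(i, j) \<notin> X" for i using colX[of i j] v j by (force simp: S_def)
    then have "v = 0\<^sub>v a" using j by (intro eq_vecI) auto
    moreover have "T \<subseteq> carrier_vec a" using T(2) cols_dim[of ?M] by auto
    ultimately show False using v T(3) N.vs_zero_lin_dep[of T] by simp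
  qed
  then have "maximal S (\<lambda>T. T \<subseteq> set (cols ?M) \<and> N.lin_indpt T)"
    using SM li by (auto simp: maximal_def)
  then show ?thesis using N.rank_card_indpt[of ?M b S] cS by simp
qed

section \<open>Minimal completions\<close>

lemma ex_strict_mono_bij_betw:
  fixes A B :: "nat set"
  assumes "finite A" "finite B" "card A = card B"
  obtains f where "bij_betw f A B" "strict_mono_on A f"
proof -
  obtain g where g: "bij_betw g {..<card A} A" "strict_mono_on {..<card A} g"
    using ex_bij_betw_strict_mono_card[OF assms(1)] .
  obtain h where h: "bij_betw h {..<card A} B" "strict_mono_on {..<card A} h"
    using ex_bij_betw_strict_mono_card[OF assms(2)] assms(3) by metis
  define f where "f = h \<circ> inv_into {..<card A} g"
  have gi: "bij_betw (inv_into {..<card A} g) A {..<card A}"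
    using bij_betw_inv_into[OF g(1)] .
  have "bij_betw f A B" unfolding f_def using bij_betw_trans[OF gi h(1)] .
  moreover have "strict_mono_on A f"
  proof (rule strict_mono_onI)
    fix x y assume xy: "x \<in> A" "y \<in> A" "x < y"
    define s t where "s = inv_into {..<card A} g x" and "t = inv_into {..<card A} g y"
    have st: "s \<in> {..<card A}" "t \<in> {..<card A}" "g s = x" "g t = y"
      using xy gi g(1) unfolding s_def t_def
      by (auto simp: bij_betw_def inv_into_into f_inv_into_f)
    have "s < t"
    proof (rule ccontr)
      assume "\<not> s < t"
      then consider "s = t" | "t < s" by linarith
      then show False
      proof cases
        case 2
        then have "g t < g s" using strict_mono_onD[OF g(2)] st by blast
        then show False using st xy by simp
      qed (use st xy in auto)
    qed
    then have "h s < h t" using strict_mono_onD[OF h(2)] st by blast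
    then show "f x < f y" by (simp add: f_def s_def t_def)
  qed
  ultimately show ?thesis using that by blast
qed

text \<open>\<open>X\<close> is the set of positions of the ones of a partial permutation of size \<open>a \<times> b\<close>.\<close>

definition rothe_diagram :: "nat \<Rightarrow> nat \<Rightarrow> (nat \<times> nat) set \<Rightarrow> (nat \<times> nat) set" where
  "rothe_diagram a b X =
     {(p, q). p < a \<and> q < b \<and> (\<forall>j\<le>q. (p, j) \<notin> X) \<and> (\<forall>i\<le>p. (i, q) \<notin> X)}"

lemma finite_rothe_diagram: "finite (rothe_diagram a b X)"
  by (rule finite_subset[of _ "{..<a} \<times> {..<b}"]) (auto simp: rothe_diagram_def)

text \<open>\<open>perm_length\<close> counts pairs among all natural numbers, and
  \<open>card\<close> is 0 on infinite sets, so comparisons of lengths by injections depend on this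
  finiteness.\<close>

lemma finite_inversions:
  assumes "\<sigma> permutes {..<m::nat}"
  shows "finite {(i, j). i < j \<and> \<sigma> j < \<sigma> i}"
proof (rule finite_subset[of _ "{..<m} \<times> {..<m}"])
  have out: "\<sigma> i = i" if "\<not> i < m" for i using permutes_not_in[OF assms, of i] that by auto
  have inside: "\<sigma> i < m" if "i < m" for i using permutes_in_image[OF assms, of i] that by auto
  show "{(i, j). i < j \<and> \<sigma> j < \<sigma> i} \<subseteq> {..<m} \<times> {..<m}"
  proof clarify
    fix i j assume ij: "i < j" "\<sigma> j < \<sigma> i"
    have "j < m"
    proof (rule ccontr)
      assume "\<not> j < m"
      then have "j < \<sigma> i" using out ij by simp
      then show False using inside[of i] out[of i] ij \<open>\<not> j < m\<close> by (cases "i < m") auto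
    qed
    then show "i \<in> {..<m} \<and> j \<in> {..<m}" using ij by simp
  qed
qed simp

text \<open>In a diagram box \<open>(p, q)\<close> the one of row \<open>p\<close> lies further
  right and the one of column \<open>q\<close> lies further down. The two ones are therefore an
  inversion, and distinct boxes give distinct inversions.\<close>

lemma extends_perm_length_ge:
  fixes w :: "'k::field mat"
  assumes w: "w \<in> carrier_mat a b" and ext: "extends_perm w \<sigma>"
  shows "card (rothe_diagram a b {(i, j). i < a \<and> j < b \<and> w $$ (i, j) = 1}) \<le> perm_length \<sigma>"
proof -
  let ?X = "{(i, j). i < a \<and> j < b \<and> w $$ (i, j) = 1}"
  obtain m where m: "\<sigma> permutes {..<m}"
    and iff: "\<And>i j. i < a \<Longrightarrow> j < b \<Longrightarrow> \<sigma> i = j \<longleftrightarrow> w $$ (i, j) = 1"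
    using ext w by (auto simp: extends_perm_def)
  have sinv: "\<sigma> (inv_into UNIV \<sigma> q) = q" for q using permutes_inverses(1)[OF m] .
  let ?f = "\<lambda>(p, q). (p, inv_into UNIV \<sigma> q)"
  have "inj_on ?f (rothe_diagram a b ?X)"
    by (auto simp: inj_on_def) (metis sinv)
  moreover have "?f ` rothe_diagram a b ?X \<subseteq> {(i, j). i < j \<and> \<sigma> j < \<sigma> i}"
  proof clarify
    fix p q assume "(p, q) \<in> rothe_diagram a b ?X"
    then have p: "p < a" "q < b" and row: "\<And>j. j \<le> q \<Longrightarrow> (p, j) \<notin> ?X"
      and col: "\<And>i. i \<le> p \<Longrightarrow> (i, q) \<notin> ?X" by (auto simp: rothe_diagram_def)
    have "q < \<sigma> p" using row[of "\<sigma> p"] iff[of p "\<sigma> p"] p by (cases "q < \<sigma> p") auto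
    moreover have "p < inv_into UNIV \<sigma> q"
      using col[of "inv_into UNIV \<sigma> q"] iff[of "inv_into UNIV \<sigma> q" q] p sinv by (cases "p < inv_into UNIV \<sigma> q") auto
    ultimately show "p < inv_into UNIV \<sigma> q \<and> \<sigma> (inv_into UNIV \<sigma> q) < \<sigma> p" using sinv by simp
  qed
  ultimately show ?thesis unfolding perm_length_def
    using card_inj_on_le[OF _ _ finite_inversions[OF m]] by blast
qed

text \<open>The empty rows \<open>U\<close> receive their ones in new columns and the empty columns
  \<open>V\<close> in new rows, both in increasing order. No inversion then lies within the new rows
  or within the new columns, so every inversion comes from a diagram box.\<close>

lemma ex_minimal_extension:
  fixes X :: "(nat \<times> nat) set"
  assumes X: "X \<subseteq> {..<a} \<times> {..<b}" and fst: "inj_on fst X" and snd: "inj_on snd X"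
  obtains \<sigma> m where "\<sigma> permutes {..<m}" "\<And>i j. i < a \<Longrightarrow> j < b \<Longrightarrow> \<sigma> i = j \<longleftrightarrow> (i, j) \<in> X"
    "perm_length \<sigma> \<le> card (rothe_diagram a b X)"
proof -
  define R C where "R = fst ` X" and "C = snd ` X"
  define U V where "U = {..<a} - R" and "V = {..<b} - C"
  have RC: "R \<subseteq> {..<a}" "C \<subseteq> {..<b}" using X by (auto simp: R_def C_def)
  have finX: "finite X" using X finite_subset by blast
  have cards: "card R = card X" "card C = card X"
    using card_image[OF fst] card_image[OF snd] by (auto simp: R_def C_def)
  have cU: "card U + card X = a" and cV: "card V + card X = b"
    using RC card_Diff_subset[of R "{..<a}"] card_Diff_subset[of C "{..<b}"] finX
      card_mono[OF _ RC(1)] card_mono[OF _ RC(2)] cards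
    by (auto simp: U_def V_def R_def C_def)
  \<comment> \<open>There is one new row for every empty column; counting the columns instead gives
    the same size.\<close>
  define m where "m = a + card V"
  have m: "m = b + card U" using cU cV by (simp add: m_def)
  have fin: "finite U" "finite V" by (auto simp: U_def V_def)
  obtain f where f: "bij_betw f U {b..<m}" "strict_mono_on U f"
    by (rule ex_strict_mono_bij_betw[of U "{b..<m}"]) (simp_all add: fin m)
  obtain g where g: "bij_betw g {a..<m} V" "strict_mono_on {a..<m} g"
    by (rule ex_strict_mono_bij_betw[of "{a..<m}" V]) (simp_all add: fin m_def)
  define h where "h = snd \<circ> inv_into X fst"
  have h: "bij_betw h R C"
    unfolding h_def R_def C_def
    using bij_betw_trans[OF bij_betw_inv_into[of fst X "fst ` X"], of snd] fst snd
    by (simp add: bij_betw_def)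
  have hX: "(i, j) \<in> X \<longleftrightarrow> i \<in> R \<and> h i = j" for i j
  proof
    assume ij: "(i, j) \<in> X"
    then have "inv_into X fst i = (i, j)" using inv_into_f_f[OF fst ij] by simp
    then show "i \<in> R \<and> h i = j" using ij by (force simp: R_def h_def)
  next
    assume i: "i \<in> R \<and> h i = j"
    then have "inv_into X fst i \<in> X" "fst (inv_into X fst i) = i"
      unfolding R_def by (auto intro: inv_into_into f_inv_into_f)
    then show "(i, j) \<in> X" using i by (simp add: h_def) (metis prod.collapse)
  qed
  define \<sigma> where "\<sigma> i = (if i \<in> R then h i else if i \<in> U then f i else if i < m then g i else i)" for i
  have part: "{..<m} = R \<union> (U \<union> {a..<m})" "{..<m} = C \<union> (V \<union> {b..<m})"
    using RC m_def m by (auto simp: U_def V_def)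
  have dj: "R \<inter> U = {}" "R \<inter> {a..<m} = {}" "U \<inter> {a..<m} = {}"
    using RC by (auto simp: U_def)
  have sR: "\<sigma> i = h i" if "i \<in> R" for i using that by (simp add: \<sigma>_def)
  have sU: "\<sigma> i = f i" if "i \<in> U" for i using that dj by (auto simp: \<sigma>_def)
  have sE: "\<sigma> i = g i" if "i \<in> {a..<m}" for i using that dj by (auto simp: \<sigma>_def)
  have b1: "bij_betw \<sigma> R C" using h sR by (simp cong: bij_betw_cong)
  have b2: "bij_betw \<sigma> U {b..<m}" using f(1) sU by (simp cong: bij_betw_cong)
  have b3: "bij_betw \<sigma> {a..<m} V" using g(1) bij_betw_cong[of "{a..<m}" \<sigma> g V] sE by blast
  have "bij_betw \<sigma> (U \<union> {a..<m}) ({b..<m} \<union> V)"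
    by (rule bij_betw_combine[OF b2 b3]) (auto simp: V_def)
  then have "bij_betw \<sigma> (R \<union> (U \<union> {a..<m})) (C \<union> ({b..<m} \<union> V))"
    by (rule bij_betw_combine[OF b1]) (use RC in \<open>auto simp: V_def\<close>)
  then have "bij_betw \<sigma> {..<m} {..<m}" using part by (simp add: Un_commute Un_left_commute)
  moreover have "\<sigma> i = i" if "i \<notin> {..<m}" for i
    using that RC m_def by (auto simp: \<sigma>_def U_def)
  ultimately have perm: "\<sigma> permutes {..<m}" by (rule bij_imp_permutes)
  have iff: "\<sigma> i = j \<longleftrightarrow> (i, j) \<in> X" if "i < a" "j < b" for i j
  proof (cases "i \<in> R")
    case True
    then show ?thesis using hX sR by auto
  next
    case False
    then have "i \<in> U" using that by (simp add: U_def)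
    then have "\<sigma> i \<in> {b..<m}" using b2 by (auto simp: bij_betw_def)
    then show ?thesis using that False hX by auto
  qed
  \<comment> \<open>Two rows from \<open>a\<close> on are filled increasingly by \<open>g\<close>,
    and two columns from \<open>b\<close> on by \<open>f\<close>; hence the upper row of an
    inversion and its left column both belong to the original matrix.\<close>
  have low: "i < a \<and> \<sigma> j < b" if ij: "i < j" "\<sigma> j < \<sigma> i" for i j
  proof -
    have jm: "j < m"
    proof (rule ccontr)
      assume "\<not> j < m"
      then have "\<sigma> j = j" using permutes_not_in[OF perm] by simp
      then show False using ij \<open>\<not> j < m\<close> permutes_in_image[OF perm, of i] permutes_not_in[OF perm, of i]
        by (cases "i < m") auto
    qed
    have "i < a"
    proof (rule ccontr)
      assume "\<not> i < a"
      then have "i \<in> {a..<m}" "j \<in> {a..<m}" using ij jm by auto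
      then have "\<sigma> i < \<sigma> j" using strict_mono_onD[OF g(2)] ij sE by simp
      then show False using ij by simp
    qed
    moreover have "\<sigma> j < b"
    proof (rule ccontr)
      assume nb: "\<not> \<sigma> j < b"
      have inU: "k \<in> U" if "k < m" "\<not> \<sigma> k < b" for k
      proof (rule ccontr)
        assume "k \<notin> U"
        moreover have "k \<in> R \<union> (U \<union> {a..<m})" using that(1) part(1) by blast
        ultimately have "k \<in> R \<or> k \<in> {a..<m}" by blast
        then have "\<sigma> k \<in> C \<or> \<sigma> k \<in> V" using b1 b3 by (auto simp: bij_betw_def)
        then show False using that RC by (auto simp: V_def)
      qed
      have "i \<in> U" "j \<in> U" using inU nb ij jm by auto
      then have "\<sigma> i < \<sigma> j" using strict_mono_onD[OF f(2)] ij sU by simp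
      then show False using ij by simp
    qed
    ultimately show ?thesis by simp
  qed
  let ?f = "\<lambda>(i, j). (i, \<sigma> j)"
  have inj: "\<sigma> i = \<sigma> j \<longleftrightarrow> i = j" for i j using permutes_inj[OF perm] by (simp add: inj_eq)
  have "inj_on ?f {(i, j). i < j \<and> \<sigma> j < \<sigma> i}" using inj by (auto simp: inj_on_def)
  moreover have "?f ` {(i, j). i < j \<and> \<sigma> j < \<sigma> i} \<subseteq> rothe_diagram a b X"
  proof clarify
    fix i j assume ij: "i < j" "\<sigma> j < \<sigma> i"
    have "(i, k) \<notin> X" if "k \<le> \<sigma> j" for k using iff[of i k] low[OF ij] that ij by auto
    moreover have "(k, \<sigma> j) \<notin> X" if "k \<le> i" for k
      using iff[of k "\<sigma> j"] low[OF ij] that ij inj[of k j] by auto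
    ultimately show "(i, \<sigma> j) \<in> rothe_diagram a b X"
      using low[OF ij] by (auto simp: rothe_diagram_def)
  qed
  ultimately have "perm_length \<sigma> \<le> card (rothe_diagram a b X)"
    unfolding perm_length_def using card_inj_on_le[OF _ _ finite_rothe_diagram] by blast
  then show ?thesis using that perm iff by blast
qed

text \<open>The length of the chosen minimiser is squeezed between the diagram bound, valid for
  every extension, and the explicit extension that attains it.\<close>

lemma perm_length_completion:
  fixes w :: "'k::field mat"
  assumes w: "w \<in> carrier_mat a b"
    and X: "X = {(i, j). i < a \<and> j < b \<and> w $$ (i, j) = 1}"
    and inj: "inj_on fst X" "inj_on snd X"
  shows "perm_length (completion w) = card (rothe_diagram a b X)"
proof -
  have sub: "X \<subseteq> {..<a} \<times> {..<b}" using X by auto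
  obtain \<sigma> m where s: "\<sigma> permutes {..<m}" "\<And>i j. i < a \<Longrightarrow> j < b \<Longrightarrow> \<sigma> i = j \<longleftrightarrow> (i, j) \<in> X"
    "perm_length \<sigma> \<le> card (rothe_diagram a b X)"
    by (rule ex_minimal_extension[OF sub inj]) blast
  have ext: "extends_perm w \<sigma>" unfolding extends_perm_def using s w X by auto
  have "extends_perm w (completion w)" "perm_length (completion w) \<le> perm_length \<sigma>"
    unfolding completion_def
    using arg_min_natI[of "extends_perm w", OF ext] arg_min_nat_le[of "extends_perm w", OF ext] by auto
  then show ?thesis using extends_perm_length_ge[OF w] s(3) X by fastforce
qed

section \<open>Pipes\<close>

text \<open>All pipes are run simultaneously: at time \<open>k\<close> a pipe is about to enter a box \<open>(q, p)\<close> of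
  content \<open>p - q = k + 1 - d\<close>, and its position along this diagonal, read from northwest
  to southeast, is \<open>2 q - 1\<close> if it enters from the west and \<open>2 q\<close> if it enters from the south.
  Outside the grid all boxes count as crossings, so that pipes wait in their row before
  they start and keep moving north after they exit.\<close>

definition ext_cross :: "(nat \<times> nat) set \<Rightarrow> int \<Rightarrow> int \<Rightarrow> bool" where
  "ext_cross D q p \<longleftrightarrow> q \<le> 0 \<or> p \<le> 0 \<or> (nat q, nat p) \<in> D"

text \<open>Leaving the box \<open>(q, q + c)\<close>, a pipe enters \<open>(q, q + c + 1)\<close>
  from the west, at position \<open>2 * q - 1\<close>, or \<open>(q - 1, q + c)\<close> from the
  south, at position \<open>2 * q - 2\<close>. An elbow lowers the position by 1 in either case; a
  crossing leaves a pipe from the west where it is and lowers one from the south by 2.\<close>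

definition next_pos :: "(nat \<times> nat) set \<Rightarrow> int \<Rightarrow> int \<Rightarrow> int" where
  "next_pos D c s =
     (let q = (s + 1) div 2
      in if ext_cross D q (q + c) then (if odd s then s else s - 2) else s - 1)"

primrec pipe_pos :: "(nat \<times> nat) set \<Rightarrow> nat \<Rightarrow> nat \<Rightarrow> nat \<Rightarrow> int" where
  "pipe_pos D d x 0 = 2 * int x - 1"
| "pipe_pos D d x (Suc k) = next_pos D (int k + 1 - int d) (pipe_pos D d x k)"

lemma next_pos_west: "next_pos D c (2 * q - 1) = (if ext_cross D q (q + c) then 2 * q - 1 else 2 * q - 2)"
  by (simp add: next_pos_def)

lemma next_pos_south: "next_pos D c (2 * q) = (if ext_cross D q (q + c) then 2 * q - 2 else 2 * q - 1)"
proof -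
  have "(2 * q + 1) div 2 = q" by simp
  then show ?thesis by (simp add: next_pos_def)
qed

lemma int_parity_cases: obtains q :: int where "s = 2 * q - 1" | q where "s = 2 * q"
proof (cases "even s")
  case True
  then show ?thesis using that(2) by (auto elim: evenE)
next
  case False
  then obtain k where "s = 2 * k + 1" by (auto elim: oddE)
  then have "s = 2 * (k + 1) - 1" by simp
  then show ?thesis using that(1) by blast
qed

lemma next_pos_bounds: "s - 2 \<le> next_pos D c s" "next_pos D c s \<le> s"
  by (cases s rule: int_parity_cases; simp add: next_pos_west next_pos_south)+

lemma next_pos_swap:
  assumes "s < s'" "next_pos D c s' \<le> next_pos D c s"
  obtains q where "s = 2 * q - 1" "s' = 2 * q" "ext_cross D q (q + c)"
    "next_pos D c s' < next_pos D c s"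
proof (cases s rule: int_parity_cases)
  case (1 q)
  note s = this
  show ?thesis
  proof (cases s' rule: int_parity_cases)
    case (1 q')
    then have "q < q'" using assms s by simp
    then show ?thesis using assms s 1 by (simp add: next_pos_west split: if_splits)
  next
    case (2 q')
    then have "q \<le> q'" using assms s by simp
    show ?thesis
    proof (cases "q = q'")
      case True
      then have "ext_cross D q (q + c)"
        using assms s 2 by (simp add: next_pos_west next_pos_south split: if_splits)
      then show ?thesis using that[of q] s 2 True by (simp add: next_pos_west next_pos_south)
    next
      case False
      then show ?thesis using assms s 2 \<open>q \<le> q'\<close>
        by (simp add: next_pos_west next_pos_south split: if_splits)
    qed
  qed
next
  case (2 q)
  note s = this
  show ?thesis
  proof (cases s' rule: int_parity_cases)
    case (1 q')
    then have "q < q'" using assms s by simp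
    then show ?thesis using assms s 1 by (simp add: next_pos_west next_pos_south split: if_splits)
  next
    case (2 q')
    then have "q < q'" using assms s by simp
    then show ?thesis using assms s 2 by (simp add: next_pos_south split: if_splits)
  qed
qed

lemma pipe_pos_antimono:
  assumes "k \<le> k'" shows "pipe_pos D d x k' \<le> pipe_pos D d x k"
  using assms
proof (induction k' rule: dec_induct)
  case (step m)
  then show ?case using next_pos_bounds(2)[of D "int m + 1 - int d" "pipe_pos D d x m"] by simp
qed simp

lemma pipe_pos_add_ge: "pipe_pos D d x k - 2 * int i \<le> pipe_pos D d x (k + i)"
proof (induction i)
  case (Suc i)
  then show ?case
    using next_pos_bounds(1)[of "pipe_pos D d x (k + i)" D "int (k + i) + 1 - int d"] by simp
qed simp

lemma pipe_pos_distinct: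
  assumes "x \<noteq> y" shows "pipe_pos D d x k \<noteq> pipe_pos D d y k"
proof (induction k)
  case 0
  then show ?case using assms by simp
next
  case (Suc k)
  define s t where "s = pipe_pos D d x k" and "t = pipe_pos D d y k"
  have "s \<noteq> t" using Suc by (simp add: s_def t_def)
  then consider "s < t" | "t < s" by linarith
  then have "next_pos D c s \<noteq> next_pos D c t" for c
    by cases (metis next_pos_swap order_less_irrefl order_refl)+
  then show ?case by (simp add: s_def t_def)
qed

section \<open>Positions at a time versus edges on a pipe\<close>

lemma pipe_pos_start:
  assumes "x + k \<le> d" shows "pipe_pos D d x k = 2 * int x - 1"
  using assms
proof (induction k)
  case (Suc k)
  then have "ext_cross D (int x) (int x + (int k + 1 - int d))" by (simp add: ext_cross_def)
  then show ?case using Suc by (simp add: next_pos_west)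
qed simp

text \<open>Odd positions are vertical edges and even ones horizontal edges. The side conditions cut
  off the two fictitious phases: \<open>d \<le> x + k\<close> excludes the waiting time, and
  \<open>0 \<le> q\<close> excludes the time after the exit, when the position is even and
  negative.\<close>

lemma pipe_edge_at_time:
  assumes x: "1 \<le> x" "x \<le> d"
  shows "(\<forall>q. pipe_pos D d x k = 2 * q - 1 \<longrightarrow> 1 \<le> q \<and>
            (d \<le> x + k \<longrightarrow> 0 \<le> q + int k - int d \<and> Vert (nat q) (nat (q + int k - int d)) \<in> pipe D x)) \<and>
         (\<forall>q. pipe_pos D d x k = 2 * q \<and> 0 \<le> q \<longrightarrow> 1 \<le> q + int k + 1 - int d \<and>
            Horiz (nat q) (nat (q + int k + 1 - int d)) \<in> pipe D x)"
    (is "?V k \<and> ?H k")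
proof (induction k)
  case 0
  have "Vert x 0 \<in> pipe D x" by (rule pipe.start)
  moreover have "2 * q \<noteq> 2 * int x - 1" for q by presburger
  ultimately show ?case using x by (auto simp: eq_commute[of "2 * _"])
next
  case (Suc k)
  define c where "c = int k + 1 - int d"
  have step: "pipe_pos D d x (Suc k) = next_pos D c (pipe_pos D d x k)" by (simp add: c_def)
  have par: "2 * q - 1 \<noteq> 2 * (q'::int)" "2 * q' \<noteq> 2 * q - 1" for q q' by presburger+
  \<comment> \<open>By parity only one of the two conjuncts is not vacuous at a given time:
    \<open>V_step\<close> treats the arrival at a vertical edge, \<open>H_step\<close> the arrival
    at a horizontal one.\<close>
  have V_step: "?V (Suc k) \<and> ?H (Suc k)"
    if a: "pipe_pos D d x (Suc k) = 2 * a - 1" "1 \<le> a"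
      "d \<le> x + Suc k \<Longrightarrow> 0 \<le> a + c \<and> Vert (nat a) (nat (a + c)) \<in> pipe D x" for a
  proof (intro conjI allI impI; (elim conjE)?)
    fix q assume "pipe_pos D d x (Suc k) = 2 * q - 1"
    then have [simp]: "q = a" using a(1) by simp
    have c: "a + int (Suc k) - int d = a + c" by (simp add: c_def)
    show "1 \<le> q" using a by simp
    assume "d \<le> x + Suc k"
    then show "0 \<le> q + int (Suc k) - int d" "Vert (nat q) (nat (q + int (Suc k) - int d)) \<in> pipe D x"
      using a(3) unfolding \<open>q = a\<close> c by auto
  next
    fix q assume "pipe_pos D d x (Suc k) = 2 * q"
    then have False using a(1) par by metis
    then show "1 \<le> q + int (Suc k) + 1 - int d"
      "Horiz (nat q) (nat (q + int (Suc k) + 1 - int d)) \<in> pipe D x" by auto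
  qed
  have H_step: "?V (Suc k) \<and> ?H (Suc k)"
    if a: "pipe_pos D d x (Suc k) = 2 * a"
      "0 \<le> a \<Longrightarrow> 1 \<le> a + 1 + c \<and> Horiz (nat a) (nat (a + 1 + c)) \<in> pipe D x" for a
  proof (intro conjI allI impI; (elim conjE)?)
    fix q assume "pipe_pos D d x (Suc k) = 2 * q - 1"
    then have False using a(1) par by metis
    then show "1 \<le> q" "0 \<le> q + int (Suc k) - int d"
      "Vert (nat q) (nat (q + int (Suc k) - int d)) \<in> pipe D x" by auto
  next
    fix q assume "pipe_pos D d x (Suc k) = 2 * q" "0 \<le> q"
    moreover from this have "q = a" using a(1) by simp
    moreover have c: "a + int (Suc k) + 1 - int d = a + 1 + c" by (simp add: c_def)
    ultimately show "1 \<le> q + int (Suc k) + 1 - int d"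
      "Horiz (nat q) (nat (q + int (Suc k) + 1 - int d)) \<in> pipe D x" using a(2) by (simp_all only: c)
  qed
  show ?case
  proof (cases "pipe_pos D d x k" rule: int_parity_cases)
    case (1 q)
    have q: "1 \<le> q" using Suc 1 by blast
    have V: "0 \<le> q + c - 1 \<and> Vert (nat q) (nat (q + c - 1)) \<in> pipe D x" if "d \<le> x + k"
      using Suc 1 that by (simp add: c_def algebra_simps)
    show ?thesis
    proof (cases "d \<le> x + k")
      case True
      then have V: "0 \<le> q + c - 1" "Vert (nat q) (nat (q + c - 1)) \<in> pipe D x" using V by auto
      define a b where "a = nat q - 1" and "b = nat (q + c - 1)"
      have ab: "nat q = Suc a" "nat (q + c) = Suc b" "nat (q - 1) = a" using q V by (auto simp: a_def b_def)
      have Vab: "Vert (Suc a) b \<in> pipe D x" using V ab by (simp add: b_def)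
      show ?thesis
      proof (cases "ext_cross D q (q + c)")
        case True
        then have "(Suc a, Suc b) \<in> D" using q V ab by (simp add: ext_cross_def)
        then have "Vert (nat q) (nat (q + c)) \<in> pipe D x" using pipe.cross_west[OF Vab] ab by simp
        moreover have "pipe_pos D d x (Suc k) = 2 * q - 1" using step 1 True by (simp add: next_pos_west)
        ultimately show ?thesis using q V by (intro V_step) auto
      next
        case False
        then have "(Suc a, Suc b) \<notin> D" using q V ab by (simp add: ext_cross_def)
        then have "Horiz (nat (q - 1)) (nat (q + c)) \<in> pipe D x" using pipe.elbow_west[OF Vab] ab by simp
        moreover have "pipe_pos D d x (Suc k) = 2 * (q - 1)" using step 1 False by (simp add: next_pos_west)
        ultimately show ?thesis using q V by (intro H_step[of "q - 1"]) auto
      qed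
    next
      case False
      then have "pipe_pos D d x (Suc k) = 2 * int x - 1" by (intro pipe_pos_start) simp
      \<comment> \<open>Either the pipe keeps waiting, or \<open>d = x + Suc k\<close> and it now
        stands at its starting edge in column 0.\<close>
      moreover have "int x + c = 0" if "d \<le> x + Suc k" using that False by (simp add: c_def)
      moreover have "Vert x 0 \<in> pipe D x" by (rule pipe.start)
      ultimately show ?thesis using x by (intro V_step[of "int x"]) auto
    qed
  next
    case (2 q)
    show ?thesis
    proof (cases "1 \<le> q")
      case False
      \<comment> \<open>The pipe has already left the grid and keeps climbing through fictitious
        crossings.\<close>
      then have "pipe_pos D d x (Suc k) = 2 * (q - 1)" using step 2 by (simp add: next_pos_south ext_cross_def)
      then show ?thesis using False by (intro H_step[of "q - 1"]) auto
    next
      case q: True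
      have H: "1 \<le> q + c" "Horiz (nat q) (nat (q + c)) \<in> pipe D x"
        using Suc 2 q by (auto simp: c_def algebra_simps)
      have late: "d \<le> x + k"
      proof (rule ccontr)
        assume "\<not> d \<le> x + k"
        then show False using pipe_pos_start[of x k d D] 2 par by simp
      qed
      define a b where "a = nat q - 1" and "b = nat (q + c - 1)"
      have ab: "nat q = Suc a" "nat (q + c) = Suc b" "nat (q - 1) = a" using q H by (auto simp: a_def b_def)
      have Hab: "Horiz (Suc a) (Suc b) \<in> pipe D x" using H ab by simp
      show ?thesis
      proof (cases "ext_cross D q (q + c)")
        case True
        then have "(Suc a, Suc b) \<in> D" using q H ab by (simp add: ext_cross_def)
        then have "Horiz (nat (q - 1)) (nat (q + c)) \<in> pipe D x" using pipe.cross_south[OF Hab] ab by simp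
        moreover have "pipe_pos D d x (Suc k) = 2 * (q - 1)" using step 2 True by (simp add: next_pos_south)
        ultimately show ?thesis using q H by (intro H_step[of "q - 1"]) auto
      next
        case False
        then have "(Suc a, Suc b) \<notin> D" using q H ab by (simp add: ext_cross_def)
        then have "Vert (nat q) (nat (q + c)) \<in> pipe D x" using pipe.elbow_south[OF Hab] ab by simp
        moreover have "pipe_pos D d x (Suc k) = 2 * q - 1" using step 2 False by (simp add: next_pos_south)
        ultimately show ?thesis using q H by (intro V_step[of q]) auto
      qed
    qed
  qed
qed

text \<open>The time is forced by the content of the box entered next: \<open>(q, p + 1)\<close>
  after \<open>Vert q p\<close>, and \<open>(q, p)\<close> after \<open>Horiz q p\<close>. The
  bounds of \<open>q\<close> by \<open>x\<close> are carried along because they keep the subtraction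
  of natural numbers from truncating.\<close>

lemma pipe_pos_of_edge:
  assumes x: "1 \<le> x" "x \<le> d" and E: "E \<in> pipe D x"
  shows "case E of
      Vert q p \<Rightarrow> 1 \<le> q \<and> q \<le> x \<and> pipe_pos D d x (p + d - q) = 2 * int q - 1
    | Horiz q p \<Rightarrow> 1 \<le> p \<and> q < x \<and> pipe_pos D d x (p + d - 1 - q) = 2 * int q"
  using E
proof induction
  case start
  then show ?case using x pipe_pos_start[of x "d - x" d] by simp
next
  case (cross_west q p)
  define k where "k = p + d - Suc q"
  have k: "Suc p + d - Suc q = Suc k" "int (Suc q) + (int k + 1 - int d) = int (Suc p)"
    using cross_west x by (auto simp: k_def)
  have "ext_cross D (int (Suc q)) (int (Suc p))" using cross_west by (simp add: ext_cross_def nat_add_distrib)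
  moreover have "pipe_pos D d x k = 2 * int (Suc q) - 1" using cross_west by (simp add: k_def)
  ultimately have "pipe_pos D d x (Suc k) = 2 * int (Suc q) - 1"
    by (simp only: pipe_pos.simps next_pos_west k(2) if_True if_False)
  then show ?case using cross_west k(1) by simp
next
  case (elbow_west q p)
  define k where "k = p + d - Suc q"
  have k: "Suc p + d - 1 - q = Suc k" "int (Suc q) + (int k + 1 - int d) = int (Suc p)"
    using elbow_west x by (auto simp: k_def)
  have "\<not> ext_cross D (int (Suc q)) (int (Suc p))" using elbow_west by (simp add: ext_cross_def nat_add_distrib)
  moreover have "pipe_pos D d x k = 2 * int (Suc q) - 1" using elbow_west by (simp add: k_def)
  ultimately have "pipe_pos D d x (Suc k) = 2 * int (Suc q) - 2"
    by (simp only: pipe_pos.simps next_pos_west k(2) if_True if_False)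
  then show ?case using elbow_west k(1) by simp
next
  case (cross_south q p)
  define k where "k = Suc p + d - 1 - Suc q"
  have k: "Suc p + d - 1 - q = Suc k" "int (Suc q) + (int k + 1 - int d) = int (Suc p)"
    using cross_south x by (auto simp: k_def)
  have "ext_cross D (int (Suc q)) (int (Suc p))" using cross_south by (simp add: ext_cross_def nat_add_distrib)
  moreover have "pipe_pos D d x k = 2 * int (Suc q)" using cross_south by (simp add: k_def)
  ultimately have "pipe_pos D d x (Suc k) = 2 * int (Suc q) - 2"
    by (simp only: pipe_pos.simps next_pos_south k(2) if_True if_False)
  then show ?case using cross_south k(1) by simp
next
  case (elbow_south q p)
  define k where "k = Suc p + d - 1 - Suc q"
  have k: "Suc p + d - Suc q = Suc k" "int (Suc q) + (int k + 1 - int d) = int (Suc p)"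
    using elbow_south x by (auto simp: k_def)
  have "\<not> ext_cross D (int (Suc q)) (int (Suc p))" using elbow_south by (simp add: ext_cross_def nat_add_distrib)
  moreover have "pipe_pos D d x k = 2 * int (Suc q)" using elbow_south by (simp add: k_def)
  ultimately have "pipe_pos D d x (Suc k) = 2 * int (Suc q) - 1"
    by (simp only: pipe_pos.simps next_pos_south k(2) if_True if_False)
  then show ?case using elbow_south k(1) by simp
qed

lemma pipe_pos_of_Horiz:
  assumes "1 \<le> x" "x \<le> d" "Horiz q p \<in> pipe D x"
  shows "1 \<le> p" "q < x" "pipe_pos D d x (p + d - 1 - q) = 2 * int q"
  using pipe_pos_of_edge[OF assms] by auto

lemma pipe_Horiz_unique_pipe:
  assumes "1 \<le> x" "x \<le> d" "1 \<le> y" "y \<le> d" "Horiz q p \<in> pipe D x" "Horiz q p \<in> pipe D y"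
  shows "x = y"
proof (rule ccontr)
  assume "x \<noteq> y"
  then show False
    using pipe_pos_distinct[of x y D d "p + d - 1 - q"] pipe_pos_of_Horiz(3)[of x d q p D]
      pipe_pos_of_Horiz(3)[of y d q p D] assms by simp
qed

text \<open>In one unit of time the content grows by 1 while a pipe climbs at most one row, and
  whatever it does not climb it moves east.\<close>

lemma pipe_Horiz_col_le:
  assumes x: "1 \<le> x" "x \<le> d" and H: "Horiz q p \<in> pipe D x" "Horiz q' p' \<in> pipe D x" "q' \<le> q"
  shows "p \<le> p'"
proof -
  define k k' where "k = p + d - 1 - q" and "k' = p' + d - 1 - q'"
  note P = pipe_pos_of_Horiz[OF x H(1)] pipe_pos_of_Horiz[OF x H(2)]
  have pos: "pipe_pos D d x k = 2 * int q" "pipe_pos D d x k' = 2 * int q'"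
    using P by (auto simp: k_def k'_def)
  have ik: "int k = int p + int d - 1 - int q" "int k' = int p' + int d - 1 - int q'"
    using P x by (auto simp: k_def k'_def)
  show ?thesis
  proof (cases "k \<le> k'")
    case True
    then obtain i where i: "k' = k + i" using le_Suc_ex by blast
    then have "2 * int q - 2 * int i \<le> 2 * int q'" using pipe_pos_add_ge[of D d x k i] pos by simp
    then show ?thesis using ik i by simp
  next
    case False
    then have "pipe_pos D d x k \<le> pipe_pos D d x (Suc k')" by (intro pipe_pos_antimono) simp
    also have "\<dots> < 2 * int q'" using pos by (simp add: next_pos_south)
    finally show ?thesis using pos H(3) by simp
  qed
qed

lemma pipe_Horiz_unique_col:
  assumes "1 \<le> x" "x \<le> d" "Horiz q p \<in> pipe D x" "Horiz q p' \<in> pipe D x"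
  shows "p = p'"
  using pipe_Horiz_col_le[OF assms(1,2,3,4)] pipe_Horiz_col_le[OF assms(1,2,4,3)] by simp

text \<open>The sum of the two indices of an edge grows only when a crossing is passed horizontally,
  and the boxes of \<open>D\<close> have row plus column at most \<open>d\<close>.\<close>

lemma pipe_below_antidiagonal:
  assumes D: "D \<in> pipe_dreams d" and x: "x \<le> d" and E: "E \<in> pipe D x"
  shows "case E of Vert q p \<Rightarrow> q + p \<le> d | Horiz q p \<Rightarrow> q + p \<le> d"
  using E by induction (use D x in \<open>auto simp: pipe_dreams_def\<close>)

lemma pipe_straight_up:
  assumes "Horiz q p \<in> pipe D x" "\<And>i. 1 \<le> i \<Longrightarrow> i \<le> q \<Longrightarrow> (i, p) \<in> D" "1 \<le> p"
  shows "Horiz 0 p \<in> pipe D x"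
  using assms
proof (induction q)
  case (Suc q)
  obtain p' where p: "p = Suc p'" using Suc(4) by (cases p) auto
  have "Horiz q p \<in> pipe D x" unfolding p
    by (rule pipe.cross_south) (use Suc p in auto)
  then show ?case using Suc by simp
qed simp

lemma pipe_straight_right:
  assumes "\<And>j. 1 \<le> j \<Longrightarrow> j \<le> p \<Longrightarrow> (x, j) \<in> D" "1 \<le> x"
  shows "Vert x p \<in> pipe D x"
  using assms
proof (induction p)
  case 0
  then show ?case by (simp add: pipe.start)
next
  case (Suc p)
  obtain x' where x: "x = Suc x'" using Suc by (cases x) auto
  have "Vert x p \<in> pipe D x" using Suc by simp
  then show ?case unfolding x by (intro pipe.cross_west) (use Suc(2)[of "Suc p"] x in auto)
qed

text \<open>A discrete intermediate value argument: a step that starts above \<open>2 * q\<close>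
  cannot jump below it, since only even positions drop by 2. The first position at most
  \<open>2 * q\<close> is therefore \<open>2 * q\<close> itself, a horizontal edge.\<close>

lemma pipe_crosses_line:
  assumes x: "1 \<le> x" "x \<le> d" and exit: "Horiz 0 v \<in> pipe D x" and q: "q < x"
  obtains p where "Horiz q p \<in> pipe D x"
proof -
  define K where "K = v + d - 1"
  have "pipe_pos D d x K = 0" using pipe_pos_of_Horiz[OF x exit] by (simp add: K_def)
  then have ex: "pipe_pos D d x K \<le> 2 * int q" by simp
  define k where "k = (LEAST k. pipe_pos D d x k \<le> 2 * int q)"
  have k: "pipe_pos D d x k \<le> 2 * int q" unfolding k_def using LeastI[of _ K] ex by fast
  have "\<not> pipe_pos D d x 0 \<le> 2 * int q" using q by simp
  then obtain m where m: "k = Suc m" using k by (cases k) auto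
  have "\<not> pipe_pos D d x m \<le> 2 * int q"
    using not_less_Least[of m "\<lambda>k. pipe_pos D d x k \<le> 2 * int q"] m by (simp add: k_def)
  then have gt: "2 * int q < pipe_pos D d x m" by simp
  have "pipe_pos D d x k = 2 * int q"
  proof (cases "pipe_pos D d x m" rule: int_parity_cases)
    case (1 s)
    then show ?thesis using k gt m by (simp add: next_pos_west split: if_splits)
  next
    case (2 s)
    then show ?thesis using k gt m by (simp add: next_pos_south split: if_splits)
  qed
  then have "Horiz q (nat (int q + int k + 1 - int d)) \<in> pipe D x"
    using pipe_edge_at_time[OF x, of D k] by (metis nat_int of_nat_0_le_iff)
  then show ?thesis using that by blast
qed

text \<open>The content of the crossing records the time of the swap, so swaps at different times
  come from different crossing tiles.\<close>

lemma swap_crossing: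
  assumes x: "1 \<le> x" "x \<le> d" and y: "1 \<le> y" "y \<le> d"
    and s: "pipe_pos D d x k < pipe_pos D d y k" "pipe_pos D d y (Suc k) < pipe_pos D d x (Suc k)"
  obtains q p where "(q, p) \<in> crossings D x y" "int p - int q = int k + 1 - int d"
proof -
  define c where "c = int k + 1 - int d"
  obtain q where q: "pipe_pos D d x k = 2 * q - 1" "pipe_pos D d y k = 2 * q" "ext_cross D q (q + c)"
    using next_pos_swap[of "pipe_pos D d x k" "pipe_pos D d y k" D c] s by (auto simp: c_def)
  have q1: "1 \<le> q" using pipe_edge_at_time[OF x, of D k] q by blast
  then have H: "1 \<le> q + c" "Horiz (nat q) (nat (q + c)) \<in> pipe D y"
    using pipe_edge_at_time[OF y, of D k] q by (auto simp: c_def algebra_simps)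
  have D: "(nat q, nat (q + c)) \<in> D" using q q1 H by (simp add: ext_cross_def)
  \<comment> \<open>A waiting pipe faces a box in a column at most 0, but \<open>y\<close> enters
    this box inside the grid.\<close>
  have late: "d \<le> x + k"
  proof (rule ccontr)
    assume "\<not> d \<le> x + k"
    moreover from this have "q = int x" using pipe_pos_start[of x k d D] q by simp
    ultimately show False using H by (simp add: c_def)
  qed
  moreover have "nat (q + c) - 1 = nat (q + int k - int d)" using H by (simp add: c_def)
  ultimately have "Vert (nat q) (nat (q + c) - 1) \<in> pipe D x"
    using pipe_edge_at_time[OF x, of D k] q by auto
  then have "(nat q, nat (q + c)) \<in> crossings D x y" using D H by (simp add: crossings_def)
  moreover have "int (nat (q + c)) - int (nat q) = int k + 1 - int d" using q1 H by (simp add: c_def)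
  ultimately show ?thesis using that by blast
qed

section \<open>The order of two pipes in a reduced pipe dream\<close>

lemma order_change:
  assumes "f k < (g k :: int)" "g k' < f k'" "k \<le> k'" "\<And>i. f i \<noteq> g i"
  obtains i where "k \<le> i" "i < k'" "f i < g i" "g (Suc i) < f (Suc i)"
proof -
  have "\<exists>i. k \<le> i \<and> i < k' \<and> f i < g i \<and> g (Suc i) < f (Suc i)"
  proof (rule ccontr)
    assume n: "\<nexists>i. k \<le> i \<and> i < k' \<and> f i < g i \<and> g (Suc i) < f (Suc i)"
    have "f i < g i" if "k \<le> i" "i \<le> k'" for i
      using that
    proof (induction i rule: dec_induct)
      case (step i)
      then show ?case using n assms(4)[of "Suc i"] by (metis Suc_leD Suc_le_lessD linorder_neqE_linordered_idom)
    qed (use assms in simp)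
    then show False using assms by (metis order_less_asym order_refl)
  qed
  then show ?thesis using that by blast
qed

text \<open>At time 0 positions are ordered as the rows are. Being in swapped order thus already
  costs one crossing, and returning would cost a second one with a different content.\<close>

lemma reduced_order:
  assumes D: "D \<in> pipe_dreams d" and red: "reduced d D"
    and x: "1 \<le> x" and xy: "x < y" and y: "y \<le> d"
    and swapped: "pipe_pos D d y k < pipe_pos D d x k" and k: "k \<le> k'"
  shows "pipe_pos D d y k' < pipe_pos D d x k'"
proof (rule ccontr)
  assume "\<not> ?thesis"
  then have bwd: "pipe_pos D d x k' < pipe_pos D d y k'"
    using pipe_pos_distinct[of x y D d k'] xy by simp
  have start: "pipe_pos D d x 0 < pipe_pos D d y 0" using xy by simp
  obtain i where i: "i < k" "pipe_pos D d x i < pipe_pos D d y i"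
      "pipe_pos D d y (Suc i) < pipe_pos D d x (Suc i)"
    using order_change[of "pipe_pos D d x" 0 "pipe_pos D d y" k] start swapped
      pipe_pos_distinct[of x y D d] xy by (metis le0 less_irrefl)
  obtain j where j: "k \<le> j" "pipe_pos D d y j < pipe_pos D d x j"
      "pipe_pos D d x (Suc j) < pipe_pos D d y (Suc j)"
    using order_change[of "pipe_pos D d y" k "pipe_pos D d x" k'] bwd swapped k
      pipe_pos_distinct[of y x D d] xy by (metis less_irrefl)
  have xd: "x \<le> d" and y1: "1 \<le> y" using x xy y by auto
  obtain q p where a: "(q, p) \<in> crossings D x y" "int p - int q = int i + 1 - int d"
    using swap_crossing[OF x xd y1 y i(2,3)] .
  obtain q' p' where b: "(q', p') \<in> crossings D y x" "int p' - int q' = int j + 1 - int d"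
    using swap_crossing[OF y1 y x xd j(2,3)] .
  have "(q, p) \<noteq> (q', p')" using a b i j by auto
  \<comment> \<open>Finiteness ensures that \<open>card\<close> really counts the two
    crossings.\<close>
  moreover have "finite D" using D
    by (intro finite_subset[of D "{..d} \<times> {..d}"]) (auto simp: pipe_dreams_def)
  then have "finite (crossings D x y \<union> crossings D y x)"
    by (rule rev_finite_subset) (auto simp: crossings_def)
  ultimately have "2 \<le> card (crossings D x y \<union> crossings D y x)"
    using card_mono[of "crossings D x y \<union> crossings D y x" "{(q, p), (q', p')}"] a b by simp
  moreover have "card (crossings D x y \<union> crossings D y x) \<le> 1"
    using red x xy y unfolding reduced_def by auto
  ultimately show False by simp
qed

text \<open>Between the times at which two pipes meet the same horizontal line, the right one still has
  to come up to the line, so their order on the line is their order at the earlier time.\<close>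

lemma line_order:
  assumes x: "1 \<le> x" "x \<le> d" and y: "1 \<le> y" "y \<le> d"
    and H: "Horiz q p \<in> pipe D x" "Horiz q p' \<in> pipe D y" "p < p'"
    and k: "p + d - 1 - q \<le> k" "k \<le> p' + d - 1 - q"
  shows "pipe_pos D d x k < pipe_pos D d y k"
proof -
  have "pipe_pos D d x k \<le> 2 * int q"
    using pipe_pos_antimono[OF k(1)] pipe_pos_of_Horiz(3)[OF x H(1)] by metis
  moreover have "2 * int q \<le> pipe_pos D d y k"
    using pipe_pos_antimono[OF k(2)] pipe_pos_of_Horiz(3)[OF y H(2)] by metis
  moreover have "x \<noteq> y" using pipe_Horiz_unique_col[of x d q p D p'] x H by auto
  ultimately show ?thesis using pipe_pos_distinct[of x y D d k] by simp
qed

text \<open>On each line the order is read off at the arrival of the pipe that is further west: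
  \<open>y\<close> on line \<open>q\<close>, and \<open>x\<close> on line \<open>q'\<close> under
  the negated claim. Since \<open>py < px \<le> px'\<close> and \<open>q' \<le> q\<close>, the first
  arrival is not later than the second, so the swapped order would have been undone.\<close>

lemma line_swap_persists:
  assumes D: "D \<in> pipe_dreams d" "reduced d D" and x: "1 \<le> x" "x < y" "y \<le> d"
    and H: "Horiz q px \<in> pipe D x" "Horiz q py \<in> pipe D y" "py < px"
    and H': "Horiz q' px' \<in> pipe D x" "Horiz q' py' \<in> pipe D y" "q' \<le> q"
  shows "py' < px'"
proof (rule ccontr)
  have xd: "1 \<le> x" "x \<le> d" and yd: "1 \<le> y" "y \<le> d" using x by auto
  note P = pipe_pos_of_Horiz[OF xd H(1)] pipe_pos_of_Horiz[OF yd H(2)]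
  note c = pipe_Horiz_col_le[OF xd H(1) H'(1,3)]
  assume "\<not> py' < px'"
  moreover have "px' \<noteq> py'" using pipe_Horiz_unique_pipe[of x d y q' px' D] xd yd x H' by auto
  ultimately have "px' < py'" by simp
  then have "pipe_pos D d x (px' + d - 1 - q') < pipe_pos D d y (px' + d - 1 - q')"
    using line_order[OF xd yd H'(1,2)] by simp
  moreover have "pipe_pos D d y (py + d - 1 - q) < pipe_pos D d x (py + d - 1 - q)"
    using line_order[OF yd xd H(2,1)] H(3) by simp
  moreover have "py + d - 1 - q \<le> px' + d - 1 - q'" using c H(3) H'(3) by simp
  ultimately show False using reduced_order[OF D x(1,2,3)] by fastforce
qed

lemma line_swap_exit:
  assumes D: "D \<in> pipe_dreams d" "reduced d D" and x: "1 \<le> x" "x < y" "y \<le> d"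
    and H: "Horiz q px \<in> pipe D x" "Horiz q py \<in> pipe D y" "py < px"
    and E: "Horiz 0 vx \<in> pipe D x" "Horiz 0 vy \<in> pipe D y"
  shows "vy < vx"
  using line_swap_persists[OF D x H E] by simp

text \<open>If \<open>y < x\<close>, the order \<open>px < py\<close> would be a swapped one and
  would persist up to the exits, against \<open>vy < vx\<close>.\<close>

lemma line_order_exit:
  assumes D: "D \<in> pipe_dreams d" "reduced d D"
    and xd: "1 \<le> x" "x \<le> d" and yd: "1 \<le> y" "y \<le> d"
    and H: "Horiz q px \<in> pipe D x" "Horiz q py \<in> pipe D y" "px < py"
    and E: "Horiz 0 vx \<in> pipe D x" "Horiz 0 vy \<in> pipe D y" "vy < vx"
  shows "x < y"
proof (rule ccontr)
  have "x \<noteq> y" using E pipe_Horiz_unique_col[of x d 0 vx D vy] xd by auto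
  moreover assume "\<not> x < y"
  ultimately have "y < x" by simp
  then show False using line_swap_exit[OF D yd(1) _ xd(2) H(2,1,3) E(2,1)] E(3) by simp
qed

section \<open>The Zelevinsky permutation\<close>

lemma lower_sum_less:
  fixes f :: "nat \<Rightarrow> nat"
  assumes "j < j'" shows "sum f {..<j} + f j \<le> sum f {..<j'}"
proof -
  have "sum f {..<j} + f j = sum f {..<Suc j}" by simp
  also have "\<dots> \<le> sum f {..<j'}" using assms by (intro sum_mono2) auto
  finally show ?thesis .
qed

lemma upper_sum_split:
  fixes f :: "nat \<Rightarrow> nat"
  assumes "i \<le> n" shows "sum f {i<..n} + f i = sum f {i..n}"
proof -
  have "{i..n} = insert i {i<..n}" using assms by auto
  then show ?thesis by simp
qed

lemma upper_sum_less:
  fixes f :: "nat \<Rightarrow> nat"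
  assumes "i < i'" "i' \<le> n" shows "sum f {i'<..n} + f i' \<le> sum f {i<..n}"
proof -
  have "sum f {i'<..n} + f i' = sum f {i'..n}" using assms by (intro upper_sum_split) simp
  also have "\<dots> \<le> sum f {i<..n}" using assms by (intro sum_mono2) auto
  finally show ?thesis .
qed

lemma rows_above_less: "j < j' \<Longrightarrow> rows_above e j + e j \<le> rows_above e j'"
  unfolding rows_above_def by (rule lower_sum_less)

lemma rows_above_mono: "j \<le> j' \<Longrightarrow> rows_above e j \<le> rows_above e j'"
  using rows_above_less[of j j' e] by (cases "j = j'") auto

lemma cols_left_less: "i < i' \<Longrightarrow> i' \<le> n \<Longrightarrow> cols_left n e i' + e i' \<le> cols_left n e i"
  unfolding cols_left_def by (rule upper_sum_less)

lemma cols_left_mono: "i \<le> i' \<Longrightarrow> i' \<le> n \<Longrightarrow> cols_left n e i' \<le> cols_left n e i"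
  using cols_left_less[of i i' n e] by (cases "i = i'") auto

text \<open>Block columns are labelled in decreasing order, so the width to the left of block
  \<open>j\<close> is the height below it. This puts the antidiagonal of each antidiagonal block on
  that of the grid.\<close>

lemma rows_cols: "j \<le> n \<Longrightarrow> rows_above e j + e j + cols_left n e j = grid_size n e"
proof -
  assume "j \<le> n"
  then have "{..n} = {..<j} \<union> {j..n}" by auto
  then have "grid_size n e = sum e {..<j} + sum e {j..n}"
    unfolding grid_size_def by (subst sum.union_disjoint[symmetric]) auto
  then show ?thesis using upper_sum_split[OF \<open>j \<le> n\<close>, of e] by (simp add: rows_above_def cols_left_def)
qed

lemma block_row_bound: "x \<in> block_row e j \<Longrightarrow> j \<le> n \<Longrightarrow> 1 \<le> x \<and> x \<le> grid_size n e"
  using rows_cols[of j n e] by (auto simp: block_row_def)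

lemma block_col_bound: "x \<in> block_col n e i \<Longrightarrow> i \<le> n \<Longrightarrow> 1 \<le> x \<and> x \<le> grid_size n e"
  using rows_cols[of i n e] by (auto simp: block_col_def)

lemma block_row_cover:
  assumes "1 \<le> x" "x \<le> grid_size n e" obtains j where "j \<le> n" "x \<in> block_row e j"
proof -
  have "\<exists>j\<le>n. x \<in> block_row e j"
    using assms(2)
  proof (induction n)
    case 0
    then show ?case using assms(1) by (auto simp: grid_size_def block_row_def rows_above_def)
  next
    case (Suc n)
    show ?case
    proof (cases "x \<le> grid_size n e")
      case True
      then show ?thesis using Suc by (meson le_SucI)
    next
      case False
      have "rows_above e (Suc n) = grid_size n e"
        by (simp add: rows_above_def grid_size_def lessThan_Suc_atMost)
      then have "x \<in> block_row e (Suc n)" using False Suc(2) by (auto simp: block_row_def grid_size_def)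
      then show ?thesis by blast
    qed
  qed
  then show ?thesis using that by blast
qed

lemma block_col_cover:
  assumes "1 \<le> x" "x \<le> grid_size n e" obtains i where "i \<le> n" "x \<in> block_col n e i"
proof -
  define i where "i = (LEAST i. cols_left n e i < x)"
  have P: "cols_left n e n < x" using assms by (simp add: cols_left_def)
  have i: "cols_left n e i < x" "i \<le> n"
    unfolding i_def using LeastI[of "\<lambda>i. cols_left n e i < x", OF P] Least_le[of "\<lambda>i. cols_left n e i < x", OF P] by auto
  have "x \<le> cols_left n e i + e i"
  proof (cases i)
    case 0
    then show ?thesis using rows_cols[of 0 n e] assms by (simp add: rows_above_def)
  next
    case (Suc k)
    have "\<not> cols_left n e k < x" using not_less_Least[of k "\<lambda>i. cols_left n e i < x"] Suc by (simp add: i_def)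
    moreover have "cols_left n e k = cols_left n e i + e i"
    proof -
      have "{k<..n} = {i..n}" using Suc by auto
      then show ?thesis using upper_sum_split[OF i(2), of e] by (simp add: cols_left_def)
    qed
    ultimately show ?thesis by simp
  qed
  then show ?thesis using that i by (auto simp: block_col_def)
qed

lemma block_row_le_iff: "x \<in> block_row e l \<Longrightarrow> rows_above e j < x \<longleftrightarrow> j \<le> l"
  using rows_above_mono[of j l e] rows_above_less[of l j e] by (force simp: block_row_def not_le)

lemma block_col_le_iff: "x \<in> block_col n e k \<Longrightarrow> k \<le> n \<Longrightarrow> i \<le> n \<Longrightarrow> cols_left n e i < x \<longleftrightarrow> k \<le> i"
  using cols_left_mono[of k i n e] cols_left_less[of i k n e] by (force simp: block_col_def not_le)

lemma block_row_unique: "x \<in> block_row e j \<Longrightarrow> x \<in> block_row e j' \<Longrightarrow> j = j'"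
  using rows_above_less[of j j' e] rows_above_less[of j' j e] by (force simp: block_row_def linorder_neq_iff)

lemma block_col_unique:
  "x \<in> block_col n e i \<Longrightarrow> x \<in> block_col n e i' \<Longrightarrow> i \<le> n \<Longrightarrow> i' \<le> n \<Longrightarrow> i = i'"
  using cols_left_less[of i i' n e] cols_left_less[of i' i n e] by (force simp: block_col_def linorder_neq_iff)

section \<open>Telescoping sums of lace counts\<close>

lemma sum_diff_Suc_int: "(\<Sum>m\<in>{j..n}. f m - f (Suc m)) = f j - (f (Suc n) :: int)" if "j \<le> Suc n"
  using that
proof (induction n)
  case 0
  then show ?case by (cases j) auto
next
  case (Suc n)
  show ?case
  proof (cases "j \<le> Suc n")
    case True
    then show ?thesis using Suc by simp
  next
    case False
    then show ?thesis using Suc(2) by (simp add: le_Suc_eq)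
  qed
qed

lemma sum_lace_count_col: "(\<Sum>k\<le>i. lace_count n r k m) = ext_rank n r (int i) (int m) - ext_rank n r (int i) (int m + 1)"
proof (induction i)
  case 0
  then show ?case by (simp add: lace_count_def ext_rank_def)
next
  case (Suc i)
  then show ?case by (simp add: lace_count_def)
qed

text \<open>\<open>lace_count\<close> is a mixed second difference of ranks, so the sum telescopes
  in both directions; the far boundary terms vanish because \<open>ext_rank\<close> is 0 outside the
  array.\<close>

lemma sum_lace_count_rect:
  assumes "i \<le> j" "j \<le> n"
  shows "(\<Sum>m\<in>{j..n}. \<Sum>k\<le>i. lace_count n r k m) = int (r i j)"
proof -
  have "(\<Sum>m\<in>{j..n}. \<Sum>k\<le>i. lace_count n r k m) =
      (\<Sum>m\<in>{j..n}. ext_rank n r (int i) (int m) - ext_rank n r (int i) (int (Suc m)))"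
    by (simp add: sum_lace_count_col add.commute)
  also have "\<dots> = ext_rank n r (int i) (int j) - ext_rank n r (int i) (int (Suc n))"
    using assms by (intro sum_diff_Suc_int) simp
  finally show ?thesis using assms by (simp add: ext_rank_def)
qed

lemma sum_lace_count_row:
  assumes "i \<le> n"
  shows "(\<Sum>m\<in>{i..n}. lace_count n r i m) = ext_rank n r (int i) (int i) - ext_rank n r (int i - 1) (int i)"
proof -
  define f where "f m = ext_rank n r (int i) (int m) - ext_rank n r (int i - 1) (int m)" for m
  have "(\<Sum>m\<in>{i..n}. lace_count n r i m) = (\<Sum>m\<in>{i..n}. f m - f (Suc m))"
    by (intro sum.cong) (auto simp: lace_count_def f_def add.commute)
  also have "\<dots> = f i - f (Suc n)" using assms by (intro sum_diff_Suc_int) simp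
  finally show ?thesis by (simp add: f_def ext_rank_def)
qed

text \<open>The row label comes first, unlike in \<open>lace_count\<close>, so that
  \<open>block_count n r j\<close> is the profile of one block row.\<close>

definition block_count :: "nat \<Rightarrow> (nat \<Rightarrow> nat \<Rightarrow> nat) \<Rightarrow> nat \<Rightarrow> nat \<Rightarrow> int" where
  "block_count n r j i =
     (if i \<le> j then lace_count n r i j else if i = j + 1 then int (r j (j + 1)) else 0)"

text \<open>The lace counts of a block row add up to \<open>r j j - r j (j + 1)\<close>, and the
  block with \<open>i = j + 1\<close> restores the missing term. The same entry repairs the column
  sums.\<close>

lemma block_count_row_sum:
  assumes "j \<le> n" "r j j = e j"
  shows "(\<Sum>i\<le>n. block_count n r j i) = int (e j)"
proof -
  have *: "(\<Sum>i\<le>j. block_count n r j i) = int (e j) - ext_rank n r (int j) (int j + 1)"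
  proof -
    have "(\<Sum>i\<le>j. block_count n r j i) = (\<Sum>i\<le>j. lace_count n r i j)"
      by (intro sum.cong) (auto simp: block_count_def)
    then show ?thesis using assms by (simp add: sum_lace_count_col ext_rank_def)
  qed
  show ?thesis
  proof (cases "j = n")
    case True
    then show ?thesis using * by (simp add: ext_rank_def)
  next
    case False
    then have "{..n} = {..j} \<union> {Suc j..n}" using assms by auto
    then have "(\<Sum>i\<le>n. block_count n r j i) = (\<Sum>i\<le>j. block_count n r j i) + (\<Sum>i\<in>{Suc j..n}. block_count n r j i)"
      by (subst sum.union_disjoint[symmetric]) auto
    also have "(\<Sum>i\<in>{Suc j..n}. block_count n r j i) = (\<Sum>i\<in>{Suc j}. block_count n r j i)"
      using False assms by (intro sum.mono_neutral_right) (auto simp: block_count_def)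
    finally show ?thesis using * False assms by (simp add: block_count_def ext_rank_def nat_add_distrib)
  qed
qed

lemma block_count_col_sum:
  assumes "i \<le> n" "r i i = e i"
  shows "(\<Sum>j\<le>n. block_count n r j i) = int (e i)"
proof -
  have "(\<Sum>j\<in>{i..n}. block_count n r j i) = (\<Sum>j\<in>{i..n}. lace_count n r i j)"
    by (intro sum.cong) (auto simp: block_count_def)
  then have *: "(\<Sum>j\<in>{i..n}. block_count n r j i) = int (e i) - ext_rank n r (int i - 1) (int i)"
    using assms by (simp add: sum_lace_count_row ext_rank_def)
  have "{..n} = {..<i} \<union> {i..n}" using assms by auto
  then have "(\<Sum>j\<le>n. block_count n r j i) = (\<Sum>j<i. block_count n r j i) + (\<Sum>j\<in>{i..n}. block_count n r j i)"
    by (subst sum.union_disjoint[symmetric]) auto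
  moreover have "(\<Sum>j<i. block_count n r j i) = ext_rank n r (int i - 1) (int i)"
  proof (cases i)
    case 0
    then show ?thesis by (simp add: ext_rank_def)
  next
    case (Suc k)
    have "(\<Sum>j<i. block_count n r j i) = (\<Sum>j\<in>{k}. block_count n r j i)"
      using Suc by (intro sum.mono_neutral_right) (auto simp: block_count_def)
    then show ?thesis using Suc assms by (simp add: block_count_def ext_rank_def nat_add_distrib)
  qed
  ultimately show ?thesis using * by simp
qed

section \<open>Nonnegativity of the lace counts\<close>

lemma path_product_refl: "path_product e \<phi> i i = 1\<^sub>m (e i)"
  by (simp add: path_product_def)

lemma path_product_Suc_left:
  assumes "i < j" shows "path_product e \<phi> i j = \<phi> (Suc i) * path_product e \<phi> (Suc i) j"
proof -
  have "[Suc i..<Suc j] = Suc i # [Suc (Suc i)..<Suc j]" using assms by (simp add: upt_rec)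
  then show ?thesis by (simp only: path_product_def list.map foldr.simps o_apply)
qed

lemma path_product_carrier:
  assumes "\<phi> \<in> Hom n e" "i \<le> j" "j \<le> n"
  shows "path_product e \<phi> i j \<in> carrier_mat (e i) (e j)"
  using assms(2)
proof (induction i rule: inc_induct)
  case base
  then show ?case by (simp add: path_product_refl)
next
  case (step i)
  have "\<phi> (Suc i) \<in> carrier_mat (e (Suc i - 1)) (e (Suc i))"
    using assms(1,3) step(2) unfolding Hom_def by (auto dest!: PiE_mem[of _ _ _ "Suc i"])
  then show ?case using step by (simp add: path_product_Suc_left)
qed

lemma path_product_mult:
  assumes phi: "\<phi> \<in> Hom n e" and ij: "i \<le> j" "j \<le> k" "k \<le> n"
  shows "path_product e \<phi> i j * path_product e \<phi> j k = path_product e \<phi> i k"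
  using ij(1)
proof (induction i rule: inc_induct)
  case base
  show ?case using path_product_carrier[OF phi ij(2,3)] by (simp add: path_product_refl)
next
  case (step i)
  have c: "\<phi> (Suc i) \<in> carrier_mat (e i) (e (Suc i))"
    using path_product_carrier[OF phi, of i "Suc i"] step ij phi unfolding Hom_def
    by (auto dest!: PiE_mem[of _ _ _ "Suc i"])
  have "path_product e \<phi> i j * path_product e \<phi> j k =
      \<phi> (Suc i) * (path_product e \<phi> (Suc i) j * path_product e \<phi> j k)"
    using step ij path_product_Suc_left[of i j e \<phi>]
      assoc_mult_mat[OF c path_product_carrier[OF phi, of "Suc i" j] path_product_carrier[OF phi ij(2,3)]]
    by simp
  then show ?case using step ij by (simp add: path_product_Suc_left)
qed

text \<open>For \<open>0 < i\<close> and \<open>j < n\<close> this is the Frobenius inequality for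
  the three consecutive products from \<open>i - 1\<close> to \<open>i\<close>, from
  \<open>i\<close> to \<open>j\<close> and from \<open>j\<close> to \<open>j + 1\<close>. On the
  border of the array, at least two terms vanish and monotonicity of rank under multiplication is
  what remains.\<close>

lemma lace_count_nonneg:
  assumes "can_occur TYPE('k::field) n e r" "i \<le> j" "j \<le> n"
  shows "0 \<le> lace_count n r i j"
proof -
  obtain \<phi> :: "nat \<Rightarrow> 'k mat" where phi: "\<phi> \<in> Hom n e" and rank: "has_rank_array n e r \<phi>"
    using assms(1) by (auto simp: can_occur_def)
  define P where "P = path_product e \<phi>"
  have r: "r a b = vec_space.rank (e a) (P a b)" if "a \<le> b" "b \<le> n" for a b
    using rank that rank_one_mat[of "e a", where 'k = 'k]
    by (cases "a = b") (auto simp: has_rank_array_def P_def path_product_refl)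
  have car: "P a b \<in> carrier_mat (e a) (e b)" if "a \<le> b" "b \<le> n" for a b
    unfolding P_def using path_product_carrier[OF phi that] .
  have mult: "P a b * P b c = P a c" if "a \<le> b" "b \<le> c" "c \<le> n" for a b c
    unfolding P_def using path_product_mult[OF phi that] .
  have ext: "ext_rank n r (int a) (int b) = int (r a b)" if "a \<le> n" "b \<le> n" for a b
    using that by (simp add: ext_rank_def)
  show ?thesis
  proof -
    consider "i = 0" "j = n" | "i = 0" "j < n" | k where "i = Suc k" "j = n" | k where "i = Suc k" "j < n"
      using assms(3) by (cases i) (auto simp: le_less)
    then show ?thesis
    proof cases
      case *: 1
      then show ?thesis using assms by (simp add: lace_count_def ext_rank_def)
    next
      case *: 2
      have "r 0 (Suc j) \<le> r 0 j"
        using rank_mult_left_le[OF car[of 0 j] car[of j "Suc j"]] mult[of 0 j "Suc j"] * assms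
        by (simp add: r)
      moreover have "nat (int j + 1) = Suc j" by simp
      ultimately show ?thesis using * assms by (simp add: lace_count_def ext_rank_def)
    next
      case *: (3 k)
      have "r k n \<le> r i n"
        using rank_mult_right_le[OF car[of k i] car[of i n]] mult[of k i n] * assms by (simp add: r)
      moreover have "nat (1 + int k) = Suc k" by simp
      ultimately show ?thesis using * assms by (simp add: lace_count_def ext_rank_def)
    next
      case *: (4 k)
      have "r k j + r i (Suc j) \<le> r i j + r k (Suc j)"
        using rank_frobenius[OF car[of k i] car[of i j] car[of j "Suc j"]]
          mult[of k i j] mult[of i j "Suc j"] mult[of k i "Suc j"] * assms by (simp add: r)
      moreover have "nat (int j + 1) = Suc j" "nat (1 + int k) = Suc k" by simp_all
      ultimately show ?thesis using * assms by (simp add: lace_count_def ext_rank_def)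
    qed
  qed
qed

lemma block_count_nonneg:
  assumes "can_occur TYPE('k::field) n e r" "j \<le> n"
  shows "0 \<le> block_count n r j i"
  using lace_count_nonneg[OF assms(1), of i j] assms(2) by (simp add: block_count_def)

section \<open>Uniqueness of the Zelevinsky permutation\<close>

lemma card_image_strict_mono_le:
  fixes f :: "nat \<Rightarrow> nat"
  assumes "strict_mono_on A f" "x \<in> A"
  shows "card {b \<in> f ` A. b \<le> f x} = card {a \<in> A. a \<le> x}"
proof -
  have inj: "inj_on f {a \<in> A. a \<le> x}"
    using inj_on_subset[OF strict_mono_on_imp_inj_on[OF assms(1)]] by auto
  have iff: "f a \<le> f x \<longleftrightarrow> a \<le> x" if "a \<in> A" for a
    using strict_mono_onD[OF assms(1), of a x] strict_mono_onD[OF assms(1), of x a] that assms(2)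
    by (metis linorder_le_less_linear order_less_le leD)
  have "{b \<in> f ` A. b \<le> f x} = f ` {a \<in> A. a \<le> x}" using iff by auto
  then show ?thesis using card_image[OF inj] by simp
qed

lemma is_zelevinsky_perm_iff:
  "is_zelevinsky_perm n e r v \<longleftrightarrow>
     v permutes {1..grid_size n e} \<and>
     (\<forall>i\<le>n. \<forall>j\<le>n. int (card {q \<in> block_row e j. v q \<in> block_col n e i}) = block_count n r j i) \<and>
     (\<forall>j\<le>n. strict_mono_on (block_row e j) v) \<and>
     (\<forall>i\<le>n. strict_mono_on (block_col n e i) (inv_into UNIV v))"
  unfolding is_zelevinsky_perm_def block_count_def ..

lemma finite_block_row: "finite (block_row e j)"
  by (simp add: block_row_def)

text \<open>The number of entries of a block row weakly left of a given one is the position of that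
  entry in the block row, so the block counts determine its block column.\<close>

lemma zelevinsky_block_bounds:
  assumes v: "is_zelevinsky_perm n e r v" and j: "j \<le> n" and i: "i \<le> n"
    and q: "q \<in> block_row e j" "v q \<in> block_col n e i"
  defines "c \<equiv> \<lambda>i. nat (block_count n r j i)"
  shows "sum c {i<..n} < card {a \<in> block_row e j. a \<le> q}"
    "card {a \<in> block_row e j. a \<le> q} \<le> sum c {i<..n} + c i"
proof -
  let ?S = "\<lambda>i. {a \<in> block_row e j. v a \<in> block_col n e i}"
  have c: "card (?S k) = c k" if "k \<le> n" for k
    using v j that unfolding is_zelevinsky_perm_iff c_def by (metis nat_int)
  have mono: "strict_mono_on (block_row e j) v" using v j by (simp add: is_zelevinsky_perm_iff)
  have le: "a \<le> b \<longleftrightarrow> v a \<le> v b" if "a \<in> block_row e j" "b \<in> block_row e j" for a b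
    using strict_mono_onD[OF mono, of a b] strict_mono_onD[OF mono, of b a] that
    by (metis linorder_le_less_linear order_less_le leD)
  have un: "card (\<Union>k\<in>K. ?S k) = sum c K" if "K \<subseteq> {..n}" for K
  proof -
    have "card (\<Union>k\<in>K. ?S k) = (\<Sum>k\<in>K. card (?S k))"
    proof (rule card_UN_disjoint)
      show "finite K" using that finite_subset by blast
      show "\<forall>i\<in>K. finite (?S i)" by (simp add: finite_block_row)
      show "\<forall>i\<in>K. \<forall>i'\<in>K. i \<noteq> i' \<longrightarrow> ?S i \<inter> ?S i' = {}"
        using that block_col_unique by blast
    qed
    then show ?thesis using c that by (simp add: subset_iff)
  qed
  have fin: "finite {a \<in> block_row e j. a \<le> q}" by (simp add: finite_block_row)
  have "(\<Union>k\<in>{i<..n}. ?S k) \<subset> {a \<in> block_row e j. a \<le> q}"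
  proof (rule psubsetI)
    show "(\<Union>k\<in>{i<..n}. ?S k) \<subseteq> {a \<in> block_row e j. a \<le> q}"
    proof clarsimp
      fix k a assume a: "i < k" "k \<le> n" "a \<in> block_row e j" "v a \<in> block_col n e k"
      then have "v a \<le> v q" using cols_left_less[of i k n e] q(2) by (simp add: block_col_def)
      then show "a \<le> q" using le q a by blast
    qed
    have "q \<notin> (\<Union>k\<in>{i<..n}. ?S k)" using block_col_unique[OF q(2)] i by fastforce
    then show "(\<Union>k\<in>{i<..n}. ?S k) \<noteq> {a \<in> block_row e j. a \<le> q}" using q by blast
  qed
  then have "card (\<Union>k\<in>{i<..n}. ?S k) < card {a \<in> block_row e j. a \<le> q}"
    by (rule psubset_card_mono[OF fin])
  moreover have "card (\<Union>k\<in>{i<..n}. ?S k) = sum c {i<..n}" by (rule un) auto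
  ultimately show "sum c {i<..n} < card {a \<in> block_row e j. a \<le> q}" by (simp only:)
  have "{a \<in> block_row e j. a \<le> q} \<subseteq> (\<Union>k\<in>{i..n}. ?S k)"
  proof clarify
    fix a assume a: "a \<in> block_row e j" "a \<le> q"
    have "v a \<in> {1..grid_size n e}"
      using v block_row_bound[OF a(1) j] permutes_in_image[of v "{1..grid_size n e}" a]
      by (simp add: is_zelevinsky_perm_iff)
    then obtain k where k: "k \<le> n" "v a \<in> block_col n e k"
      using block_col_cover[of "v a" n e] by auto
    have "v a \<le> v q" using le a q by blast
    then have "i \<le> k" using cols_left_less[of k i n e] q(2) k i
      by (cases "k < i") (auto simp: block_col_def)
    then show "a \<in> (\<Union>k\<in>{i..n}. ?S k)" using a k by auto
  qed
  moreover have "finite (\<Union>k\<in>{i..n}. ?S k)" by (simp add: finite_block_row)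
  ultimately have "card {a \<in> block_row e j. a \<le> q} \<le> card (\<Union>k\<in>{i..n}. ?S k)"
    by (intro card_mono)
  also have "\<dots> = sum c {i..n}" by (rule un) auto
  finally have "card {a \<in> block_row e j. a \<le> q} \<le> sum c {i..n}" .
  then show "card {a \<in> block_row e j. a \<le> q} \<le> sum c {i<..n} + c i"
    using upper_sum_split[OF i, of c] by simp
qed

text \<open>The monotonicity along block rows determines the block column of each one; the
  monotonicity along block columns then determines its exact column.\<close>

lemma zelevinsky_perm_unique:
  assumes v: "is_zelevinsky_perm n e r v" and w: "is_zelevinsky_perm n e r w"
  shows "v = w"
proof
  fix q
  have pv: "v permutes {1..grid_size n e}" and pw: "w permutes {1..grid_size n e}"
    using v w by (simp_all add: is_zelevinsky_perm_iff)
  have block: "w a \<in> block_col n e i"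
    if "is_zelevinsky_perm n e r v" "is_zelevinsky_perm n e r w" "i \<le> n" "v a \<in> block_col n e i" for v w a i
  proof -
    have p: "v permutes {1..grid_size n e}" "w permutes {1..grid_size n e}"
      using that by (simp_all add: is_zelevinsky_perm_iff)
    have "v a \<in> {1..grid_size n e}" using block_col_bound that by force
    then have a: "a \<in> {1..grid_size n e}" "w a \<in> {1..grid_size n e}"
      using permutes_in_image p by metis+
    obtain j where j: "j \<le> n" "a \<in> block_row e j" using block_row_cover[of a n e] a by auto
    obtain k where k: "k \<le> n" "w a \<in> block_col n e k" using block_col_cover[of "w a" n e] a by auto
    define c where "c = (\<lambda>i. nat (block_count n r j i))"
    note B = zelevinsky_block_bounds[OF that(1) j(1) that(3) j(2) that(4)]
      zelevinsky_block_bounds[OF that(2) j(1) k(1) j(2) k(2)]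
    \<comment> \<open>The same number, the position of \<open>a\<close> in its block row, lies in
      the half-open intervals belonging to \<open>i\<close> and to \<open>k\<close>, and these are
      disjoint for different labels.\<close>
    have "k = i"
    proof (rule ccontr)
      assume "k \<noteq> i"
      then consider "k < i" | "i < k" by linarith
      then show False
        by cases (use B upper_sum_less[of k i n c] upper_sum_less[of i k n c] that(3) k(1) in \<open>auto simp: c_def\<close>)
    qed
    then show ?thesis using k by simp
  qed
  show "v q = w q"
  proof (cases "q \<in> {1..grid_size n e}")
    case False
    then show ?thesis using permutes_not_in[OF pv False] permutes_not_in[OF pw False] by simp
  next
    case True
    then have "v q \<in> {1..grid_size n e}" using permutes_in_image[OF pv] by blast
    then obtain i where i: "i \<le> n" "v q \<in> block_col n e i" using block_col_cover[of "v q" n e] by auto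
    \<comment> \<open>Inside its block column a one is placed by counting the ones of that block
      column in rows up to \<open>q\<close>.\<close>
    have pos: "x q = cols_left n e i + card {a. x a \<in> block_col n e i \<and> a \<le> q}"
      if x: "is_zelevinsky_perm n e r x" "x q \<in> block_col n e i" for x
    proof -
      let ?g = "inv_into UNIV x"
      have p: "x permutes {1..grid_size n e}" using x by (simp add: is_zelevinsky_perm_iff)
      have g: "?g (x a) = a" "x (?g a) = a" for a
        using permutes_inverses[OF p] by simp_all
      have im: "?g ` block_col n e i = {a. x a \<in> block_col n e i}"
      proof (intro equalityI subsetI)
        fix a assume "a \<in> {a. x a \<in> block_col n e i}"
        then show "a \<in> ?g ` block_col n e i" using g(1)[of a] image_eqI[of a ?g "x a"] by simp
      qed (use g in auto)
      have "card {a \<in> ?g ` block_col n e i. a \<le> ?g (x q)} = card {b \<in> block_col n e i. b \<le> x q}"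
        using card_image_strict_mono_le[of "block_col n e i" ?g "x q"] x i
        by (simp add: is_zelevinsky_perm_iff)
      moreover have "{b \<in> block_col n e i. b \<le> x q} = {cols_left n e i<..x q}"
        using x(2) by (auto simp: block_col_def)
      ultimately show ?thesis using x(2) g(1)[of q] im by (simp add: block_col_def)
    qed
    have "v a \<in> block_col n e i \<longleftrightarrow> w a \<in> block_col n e i" for a
      using block[OF v w i(1)] block[OF w v i(1)] by blast
    then show ?thesis using pos[OF v i(2)] pos[OF w block[OF v w i]] by auto
  qed
qed

section \<open>Existence of the Zelevinsky permutation\<close>

lemma card_triple_Sigma: "card (SIGMA j:A. SIGMA i:B. {..<c j i}) = (\<Sum>j\<in>A. \<Sum>i\<in>B. c j (i::nat))"
  if "finite A" "finite B" for c :: "nat \<Rightarrow> nat \<Rightarrow> nat"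
  using that by (simp add: card_SigmaI)

text \<open>Existence: the ones are indexed by triples \<open>(j, i, t)\<close>, the \<open>t\<close>-th one in the block in
  block row \<open>j\<close> and block column \<open>i\<close>, and \<open>\<alpha>\<close>, \<open>\<beta>\<close> are the row and the column of the one.\<close>

lemma ex_perm_with_block_counts:
  fixes c :: "nat \<Rightarrow> nat \<Rightarrow> nat"
  assumes row: "\<And>j. j \<le> n \<Longrightarrow> (\<Sum>i\<le>n. c j i) = e j" and col: "\<And>i. i \<le> n \<Longrightarrow> (\<Sum>j\<le>n. c j i) = e i"
  obtains v where "v permutes {1..grid_size n e}"
    "\<And>i j. i \<le> n \<Longrightarrow> j \<le> n \<Longrightarrow> card {q \<in> block_row e j. v q \<in> block_col n e i} = c j i"
    "\<And>j. j \<le> n \<Longrightarrow> strict_mono_on (block_row e j) v"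
    "\<And>i. i \<le> n \<Longrightarrow> strict_mono_on (block_col n e i) (inv_into UNIV v)"
proof -
  let ?d = "grid_size n e"
  define T where "T = (SIGMA j:{..n}. SIGMA i:{..n}. {..<c j i})"
  \<comment> \<open>Rows of a block row are filled while the block columns pass from left to right,
    that is with decreasing label; hence the ones with label above \<open>i\<close> come
    first.\<close>
  define \<alpha> where "\<alpha> = (\<lambda>(j, i, t). rows_above e j + sum (c j) {i<..n} + Suc t)"
  define \<beta> where "\<beta> = (\<lambda>(j, i, t). cols_left n e i + sum (\<lambda>j. c j i) {..<j} + Suc t)"
  have T: "(j, i, t) \<in> T \<longleftrightarrow> j \<le> n \<and> i \<le> n \<and> t < c j i" for j i t by (auto simp: T_def)
  have finT: "finite T" by (simp add: T_def)
  have cardT: "card T = ?d"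
    unfolding T_def by (simp add: card_triple_Sigma row grid_size_def)
  have \<alpha>row: "\<alpha> (j, i, t) \<in> block_row e j" if "(j, i, t) \<in> T" for j i t
  proof -
    have "sum (c j) {i<..n} + c j i = sum (c j) {i..n}" using that by (intro upper_sum_split) (simp add: T)
    also have "\<dots> \<le> sum (c j) {..n}" by (intro sum_mono2) auto
    finally show ?thesis using that row[of j] by (simp add: \<alpha>_def block_row_def T)
  qed
  have \<beta>col: "\<beta> (j, i, t) \<in> block_col n e i" if "(j, i, t) \<in> T" for j i t
  proof -
    have "sum (\<lambda>j. c j i) {..<j} + c j i = sum (\<lambda>j. c j i) {..<Suc j}" by simp
    also have "\<dots> \<le> sum (\<lambda>j. c j i) {..n}" using that by (intro sum_mono2) (auto simp: T)
    finally show ?thesis using that col[of i] by (simp add: \<beta>_def block_col_def T)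
  qed
  have \<alpha>less: "\<alpha> (j, i, t) < \<alpha> (j, i', t')" if "(j, i, t) \<in> T" "(j, i', t') \<in> T" "i' < i \<or> i' = i \<and> t < t'" for j i i' t t'
    using that upper_sum_less[of i' i n "c j"] by (auto simp: \<alpha>_def T)
  have \<beta>less: "\<beta> (j, i, t) < \<beta> (j', i, t')" if "(j, i, t) \<in> T" "(j', i, t') \<in> T" "j < j' \<or> j = j' \<and> t < t'" for j j' i t t'
    using that lower_sum_less[of j j' "\<lambda>j. c j i"] by (auto simp: \<beta>_def T)
  have \<beta>left: "\<beta> (j, i, t) < \<beta> (j', i', t')" if "(j, i, t) \<in> T" "(j', i', t') \<in> T" "i' < i" for j j' i i' t t'
    using \<beta>col[OF that(1)] \<beta>col[OF that(2)] cols_left_less[of i' i n e] that by (auto simp: block_col_def T)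
  have \<alpha>up: "\<alpha> (j, i, t) < \<alpha> (j', i', t')" if "(j, i, t) \<in> T" "(j', i', t') \<in> T" "j < j'" for j j' i i' t t'
    using \<alpha>row[OF that(1)] \<alpha>row[OF that(2)] rows_above_less[OF that(3), of e] by (auto simp: block_row_def)
  have \<alpha>inj: "inj_on \<alpha> T"
  proof (rule inj_onI)
    fix z z' assume "z \<in> T" "z' \<in> T" "\<alpha> z = \<alpha> z'"
    moreover obtain j i t j' i' t' where z: "z = (j, i, t)" "z' = (j', i', t')"
      using prod_cases3 by metis
    ultimately have *: "(j, i, t) \<in> T" "(j', i', t') \<in> T" "\<alpha> (j, i, t) = \<alpha> (j', i', t')" by simp_all
    have "j = j'" using \<alpha>up[OF *(1,2)] \<alpha>up[OF *(2,1)] *(3) by (metis less_irrefl nat_neq_iff)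
    moreover from this have "i = i'"
      using \<alpha>less[of j i t i' t'] \<alpha>less[of j i' t' i t] * by (metis less_irrefl nat_neq_iff)
    ultimately show "z = z'" using * z by (simp add: \<alpha>_def)
  qed
  have \<beta>inj: "inj_on \<beta> T"
  proof (rule inj_onI)
    fix z z' assume "z \<in> T" "z' \<in> T" "\<beta> z = \<beta> z'"
    moreover obtain j i t j' i' t' where z: "z = (j, i, t)" "z' = (j', i', t')"
      using prod_cases3 by metis
    ultimately have *: "(j, i, t) \<in> T" "(j', i', t') \<in> T" "\<beta> (j, i, t) = \<beta> (j', i', t')" by simp_all
    have "i = i'" using \<beta>left[OF *(1,2)] \<beta>left[OF *(2,1)] *(3) by (metis less_irrefl nat_neq_iff)
    moreover from this have "j = j'"
      using \<beta>less[of j i t j' t'] \<beta>less[of j' i t' j t] * by (metis less_irrefl nat_neq_iff)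
    ultimately show "z = z'" using * z by (simp add: \<beta>_def)
  qed
  have "\<alpha> ` T \<subseteq> {1..?d}" using \<alpha>row block_row_bound[of _ e _ n] by (fastforce simp: T)
  then have \<alpha>im: "\<alpha> ` T = {1..?d}"
    using card_subset_eq[of "{1..?d}" "\<alpha> ` T"] card_image[OF \<alpha>inj] cardT by simp
  have "\<beta> ` T \<subseteq> {1..?d}" using \<beta>col block_col_bound[of _ n e] by (fastforce simp: T)
  then have \<beta>im: "\<beta> ` T = {1..?d}"
    using card_subset_eq[of "{1..?d}" "\<beta> ` T"] card_image[OF \<beta>inj] cardT by simp
  define v where "v q = (if q \<in> {1..?d} then \<beta> (inv_into T \<alpha> q) else q)" for q
  have v\<alpha>: "v (\<alpha> z) = \<beta> z" if "z \<in> T" for z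
    using that \<alpha>im inv_into_f_f[OF \<alpha>inj that] by (auto simp: v_def)
  have "bij_betw (\<lambda>q. \<beta> (inv_into T \<alpha> q)) {1..?d} {1..?d}"
    using bij_betw_trans[OF bij_betw_inv_into[of \<alpha> T "{1..?d}"], of \<beta> "{1..?d}"] \<alpha>inj \<alpha>im \<beta>inj \<beta>im
    by (simp add: bij_betw_def o_def)
  then have "bij_betw v {1..?d} {1..?d}"
    using bij_betw_cong[of "{1..?d}" v "\<lambda>q. \<beta> (inv_into T \<alpha> q)" "{1..?d}"] by (simp add: v_def)
  then have perm: "v permutes {1..?d}" by (rule bij_imp_permutes) (auto simp: v_def)
  have inv\<beta>: "inv_into UNIV v (\<beta> z) = \<alpha> z" if "z \<in> T" for z
    using v\<alpha>[OF that] permutes_inverses(2)[OF perm] by metis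
  have rowE: "\<exists>i t. q = \<alpha> (j, i, t) \<and> (j, i, t) \<in> T" if "q \<in> block_row e j" "j \<le> n" for q j
  proof -
    have "q \<in> \<alpha> ` T" using block_row_bound[OF that] \<alpha>im by auto
    then obtain j' i t where "q = \<alpha> (j', i, t)" "(j', i, t) \<in> T" by auto
    moreover from this have "j' = j" using \<alpha>row block_row_unique that by metis
    ultimately show ?thesis by blast
  qed
  have colE: "\<exists>j t. q = \<beta> (j, i, t) \<and> (j, i, t) \<in> T" if "q \<in> block_col n e i" "i \<le> n" for q i
  proof -
    have "q \<in> \<beta> ` T" using block_col_bound[OF that] \<beta>im by auto
    then obtain j i' t where "q = \<beta> (j, i', t)" "(j, i', t) \<in> T" by auto
    moreover from this have "i' = i" using \<beta>col block_col_unique that T by metis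
    ultimately show ?thesis by blast
  qed
  have cnt: "card {q \<in> block_row e j. v q \<in> block_col n e i} = c j i" if ij: "i \<le> n" "j \<le> n" for i j
  proof -
    have "{q \<in> block_row e j. v q \<in> block_col n e i} = (\<lambda>t. \<alpha> (j, i, t)) ` {..<c j i}"
    proof (intro equalityI subsetI)
      fix q assume q: "q \<in> {q \<in> block_row e j. v q \<in> block_col n e i}"
      then obtain i' t where z: "q = \<alpha> (j, i', t)" "(j, i', t) \<in> T" using rowE ij by blast
      then have "i' = i" using q v\<alpha> \<beta>col block_col_unique[of "v q" n e i i'] ij T by auto
      then show "q \<in> (\<lambda>t. \<alpha> (j, i, t)) ` {..<c j i}" using z by (auto simp: T)
    next
      fix q assume "q \<in> (\<lambda>t. \<alpha> (j, i, t)) ` {..<c j i}"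
      then obtain t where "q = \<alpha> (j, i, t)" "(j, i, t) \<in> T" using ij by (auto simp: T)
      then show "q \<in> {q \<in> block_row e j. v q \<in> block_col n e i}" using \<alpha>row \<beta>col v\<alpha> by auto
    qed
    moreover have "inj_on (\<lambda>t. \<alpha> (j, i, t)) {..<c j i}" by (auto simp: inj_on_def \<alpha>_def)
    ultimately show ?thesis using card_image by fastforce
  qed
  have m1: "strict_mono_on (block_row e j) v" if j: "j \<le> n" for j
  proof (rule strict_mono_onI)
    fix q q' assume q: "q \<in> block_row e j" "q' \<in> block_row e j" "q < q'"
    obtain i t i' t' where z: "q = \<alpha> (j, i, t)" "(j, i, t) \<in> T" "q' = \<alpha> (j, i', t')" "(j, i', t') \<in> T"
      using rowE[OF q(1) j] rowE[OF q(2) j] by blast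
    have "i' < i \<or> i' = i \<and> t < t'"
    proof (rule ccontr)
      assume "\<not> ?thesis"
      then consider "i < i' \<or> i = i' \<and> t' < t" | "i = i'" "t = t'" by linarith
      then show False using \<alpha>less[OF z(4,2)] z q(3) by cases auto
    qed
    then show "v q < v q'" using \<beta>left[OF z(2,4)] \<beta>less[of j i t j t'] v\<alpha> z by auto
  qed
  have m2: "strict_mono_on (block_col n e i) (inv_into UNIV v)" if i: "i \<le> n" for i
  proof (rule strict_mono_onI)
    fix q q' assume q: "q \<in> block_col n e i" "q' \<in> block_col n e i" "q < q'"
    obtain j t j' t' where z: "q = \<beta> (j, i, t)" "(j, i, t) \<in> T" "q' = \<beta> (j', i, t')" "(j', i, t') \<in> T"
      using colE[OF q(1) i] colE[OF q(2) i] by blast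
    have "j < j' \<or> j = j' \<and> t < t'"
    proof (rule ccontr)
      assume "\<not> ?thesis"
      then consider "j' < j \<or> j' = j \<and> t' < t" | "j = j'" "t = t'" by linarith
      then show False using \<beta>less[OF z(4,2)] z q(3) by cases auto
    qed
    then show "inv_into UNIV v q < inv_into UNIV v q'"
      using \<alpha>up[OF z(2,4)] \<alpha>less[of j i t i t'] inv\<beta> z by auto
  qed
  show ?thesis using that[OF perm cnt m1 m2] by blast
qed

lemma zelevinsky_perm_exists:
  assumes occ: "can_occur TYPE('k::field) n e r"
  obtains v where "is_zelevinsky_perm n e r v"
proof -
  have rjj: "r j j = e j" if "j \<le> n" for j
    using occ that by (auto simp: can_occur_def has_rank_array_def)
  define c where "c j i = nat (block_count n r j i)" for j i
  have c: "int (c j i) = block_count n r j i" if "j \<le> n" for j i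
    using block_count_nonneg[OF occ that] by (simp add: c_def)
  have "int (\<Sum>i\<le>n. c j i) = int (e j)" if "j \<le> n" for j
    using block_count_row_sum[of j n r e] that c rjj by simp
  then have row: "(\<Sum>i\<le>n. c j i) = e j" if "j \<le> n" for j using that by (metis of_nat_eq_iff)
  have "int (\<Sum>j\<le>n. c j i) = int (e i)" if "i \<le> n" for i
    using block_count_col_sum[of i n r e] that c rjj by simp
  then have col: "(\<Sum>j\<le>n. c j i) = e i" if "i \<le> n" for i using that by (metis of_nat_eq_iff)
  obtain v where "v permutes {1..grid_size n e}"
    "\<And>i j. i \<le> n \<Longrightarrow> j \<le> n \<Longrightarrow> card {q \<in> block_row e j. v q \<in> block_col n e i} = c j i"
    "\<And>j. j \<le> n \<Longrightarrow> strict_mono_on (block_row e j) v"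
    "\<And>i. i \<le> n \<Longrightarrow> strict_mono_on (block_col n e i) (inv_into UNIV v)"
    using ex_perm_with_block_counts[of n c e, OF row col] by blast
  then have "is_zelevinsky_perm n e r v" unfolding is_zelevinsky_perm_iff using c by simp
  then show ?thesis using that by blast
qed

lemma is_zelevinsky_perm_zelevinsky_perm:
  assumes "can_occur TYPE('k::field) n e r"
  shows "is_zelevinsky_perm n e r (zelevinsky_perm n e r)"
proof -
  obtain v where v: "is_zelevinsky_perm n e r v" using zelevinsky_perm_exists[OF assms] .
  show ?thesis unfolding zelevinsky_perm_def
    by (rule theI[of _ v]) (use v zelevinsky_perm_unique[OF _ v] in blast)+
qed

text \<open>The region southeast of the corner is a union of the blocks in block rows
  \<open>m \<ge> j\<close> and block columns \<open>k \<le> i\<close>. All of them have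
  \<open>k \<le> m\<close>, so only lace counts are summed.\<close>

lemma zelevinsky_count:
  assumes v: "is_zelevinsky_perm n e r v" and ij: "i \<le> j" "j \<le> n"
  shows "card {x \<in> {1..grid_size n e}. rows_above e j < x \<and> cols_left n e i < v x} = r i j"
proof -
  let ?S = "\<lambda>(m, k). {q \<in> block_row e m. v q \<in> block_col n e k}"
  let ?K = "{j..n} \<times> {..i}"
  have p: "v permutes {1..grid_size n e}" using v by (simp add: is_zelevinsky_perm_iff)
  have "{x \<in> {1..grid_size n e}. rows_above e j < x \<and> cols_left n e i < v x} = (\<Union>z\<in>?K. ?S z)"
  proof (intro equalityI subsetI)
    fix x assume x: "x \<in> {x \<in> {1..grid_size n e}. rows_above e j < x \<and> cols_left n e i < v x}"
    then have "v x \<in> {1..grid_size n e}" using permutes_in_image[OF p] by blast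
    then obtain k where k: "k \<le> n" "v x \<in> block_col n e k" using block_col_cover[of "v x" n e] by auto
    obtain m where m: "m \<le> n" "x \<in> block_row e m" using x block_row_cover[of x n e] by auto
    have "j \<le> m" using block_row_le_iff[OF m(2)] x by simp
    moreover have "k \<le> i" using block_col_le_iff[OF k(2,1)] x ij by simp
    ultimately show "x \<in> (\<Union>z\<in>?K. ?S z)" using m k by auto
  next
    fix x assume "x \<in> (\<Union>z\<in>?K. ?S z)"
    then obtain m k where m: "j \<le> m" "m \<le> n" "x \<in> block_row e m" and k: "k \<le> i" "v x \<in> block_col n e k"
      by auto
    then show "x \<in> {x \<in> {1..grid_size n e}. rows_above e j < x \<and> cols_left n e i < v x}"
      using block_row_bound[OF m(3,2)] block_row_le_iff[OF m(3)] block_col_le_iff[OF k(2)] ij by simp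
  qed
  moreover have "card (\<Union>z\<in>?K. ?S z) = (\<Sum>z\<in>?K. card (?S z))"
  proof (rule card_UN_disjoint)
    show "\<forall>z\<in>?K. finite (?S z)" by (auto simp: finite_block_row)
    show "\<forall>z\<in>?K. \<forall>z'\<in>?K. z \<noteq> z' \<longrightarrow> ?S z \<inter> ?S z' = {}"
    proof (intro ballI impI)
      fix z z' assume z: "z \<in> ?K" "z' \<in> ?K" "z \<noteq> z'"
      obtain m k m' k' where zz: "z = (m, k)" "z' = (m', k')" by (cases z; cases z') auto
      have "q \<notin> ?S z'" if q: "q \<in> ?S z" for q
      proof
        assume q': "q \<in> ?S z'"
        have "m = m'" using block_row_unique[of q e m m'] q q' zz by simp
        moreover have "k = k'" using block_col_unique[of "v q" n e k k'] q q' z ij zz by simp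
        ultimately show False using z zz by simp
      qed
      then show "?S z \<inter> ?S z' = {}" by blast
    qed
  qed simp
  moreover have "int (\<Sum>z\<in>?K. card (?S z)) = int (r i j)"
  proof -
    have "int (\<Sum>z\<in>?K. card (?S z)) = (\<Sum>(m, k)\<in>?K. lace_count n r k m)"
      unfolding of_nat_sum
    proof (rule sum.cong[OF refl])
      fix z assume z: "z \<in> ?K"
      obtain m k where zz: "z = (m, k)" by (cases z)
      have "int (card (?S (m, k))) = block_count n r m k"
        using v z zz ij by (simp add: is_zelevinsky_perm_iff)
      then show "int (card (?S z)) = (case z of (m, k) \<Rightarrow> lace_count n r k m)"
        using z zz ij by (simp add: block_count_def)
    qed
    also have "\<dots> = (\<Sum>m\<in>{j..n}. \<Sum>k\<le>i. lace_count n r k m)" by (simp add: sum.cartesian_product)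
    finally show ?thesis using sum_lace_count_rect[OF ij] by simp
  qed
  ultimately show ?thesis by (simp only: of_nat_eq_iff)
qed

text \<open>A nonempty block in block row \<open>m\<close> has column label at most
  \<open>m + 1\<close>, hence at most \<open>j\<close> when \<open>m < j\<close>.\<close>

lemma zelevinsky_no_northwest:
  assumes v: "is_zelevinsky_perm n e r v" and j: "j \<le> n" and q: "1 \<le> q" "q \<le> rows_above e j"
  shows "cols_left n e j < v q"
proof -
  have p: "v permutes {1..grid_size n e}" using v by (simp add: is_zelevinsky_perm_iff)
  have "q \<in> {1..grid_size n e}" using q rows_cols[OF j, of e] by simp
  then have "v q \<in> {1..grid_size n e}" "q \<in> {1..grid_size n e}" using permutes_in_image[OF p] by auto
  then obtain k where k: "k \<le> n" "v q \<in> block_col n e k" using block_col_cover[of "v q" n e] by auto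
  obtain m where m: "m \<le> n" "q \<in> block_row e m"
    using \<open>q \<in> _\<close> block_row_cover[of q n e] by auto
  have "m < j" using block_row_le_iff[OF m(2), of j] q by auto
  have "card {q \<in> block_row e m. v q \<in> block_col n e k} > 0"
    using m k by (auto simp: card_gt_0_iff finite_block_row)
  then have "block_count n r m k \<noteq> 0" using v m k by (fastforce simp: is_zelevinsky_perm_iff)
  then have "k \<le> m + 1" by (auto simp: block_count_def split: if_splits)
  then show ?thesis using \<open>m < j\<close> block_col_le_iff[OF k(2,1) j] by simp
qed

section \<open>Laces\<close>

locale zelevinsky_pipe_dream =
  fixes n :: nat and e :: "nat \<Rightarrow> nat" and r :: "nat \<Rightarrow> nat \<Rightarrow> nat"
    and v :: "nat \<Rightarrow> nat" and D :: "(nat \<times> nat) set"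
  assumes v: "is_zelevinsky_perm n e r v"
    and diagonal: "\<And>i. i \<le> n \<Longrightarrow> r i i = e i"
    and D: "D \<in> RP (grid_size n e) v"
begin

definition d where "d = grid_size n e"

lemma pipe_dream: "D \<in> pipe_dreams d" and red: "reduced d D"
  using D by (auto simp: RP_def d_def)

lemma exit_edge: "1 \<le> x \<Longrightarrow> x \<le> d \<Longrightarrow> Horiz 0 (v x) \<in> pipe D x"
  using D by (auto simp: RP_def d_def)

lemma v_permutes: "v permutes {1..d}"
  using v by (simp add: is_zelevinsky_perm_iff d_def)

lemma v_bounds: assumes "1 \<le> x" "x \<le> d" shows "1 \<le> v x" "v x \<le> d"
  using permutes_in_image[OF v_permutes, of x] assms by auto

lemma exit_unique: "1 \<le> x \<Longrightarrow> x \<le> d \<Longrightarrow> Horiz 0 p \<in> pipe D x \<Longrightarrow> v x = p"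
  using pipe_Horiz_unique_col exit_edge by blast

text \<open>By induction, all boxes to the west in the same row and to the north in the same column
  are crossings. If the box itself were an elbow, pipe \<open>q\<close> would run straight to it,
  turn, and run straight up to an exit that \<open>v\<close> forbids.\<close>

lemma northwest_crosses:
  assumes j: "j \<le> n" and "1 \<le> q" "q \<le> rows_above e j" "1 \<le> p" "p \<le> cols_left n e j"
  shows "(q, p) \<in> D"
  using assms(2-)
proof (induction "q + p" arbitrary: q p rule: less_induct)
  case less
  have qd: "q \<le> d" using less rows_cols[OF j, of e] by (simp add: d_def)
  show ?case
  proof (rule ccontr)
    assume n: "(q, p) \<notin> D"
    obtain q' p' where s: "q = Suc q'" "p = Suc p'" using less by (metis Suc_le_D One_nat_def)
    have "Vert q p' \<in> pipe D q"
      by (rule pipe_straight_right) (use less s in auto)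
    then have "Horiz q' p \<in> pipe D q" using pipe.elbow_west[of q' p' D q] n s by simp
    then have "Horiz 0 p \<in> pipe D q"
      by (rule pipe_straight_up) (use less s in auto)
    then have "v q = p" using exit_unique less qd by blast
    then show False using zelevinsky_no_northwest[OF v j, of q] less by simp
  qed
qed

text \<open>The lace of \<open>x\<close> is the interval from \<open>col_block x\<close> to
  \<open>row_block x\<close>. For a one in a block with \<open>i = j + 1\<close> it is empty, and
  the pipe enters no antidiagonal block through its top.\<close>

definition row_block where "row_block x = (SOME l. l \<le> n \<and> x \<in> block_row e l)"
definition col_block where "col_block x = (SOME k. k \<le> n \<and> v x \<in> block_col n e k)"

lemma row_block: assumes "1 \<le> x" "x \<le> d" shows "row_block x \<le> n" "x \<in> block_row e (row_block x)"
proof -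
  have "\<exists>l. l \<le> n \<and> x \<in> block_row e l" using block_row_cover[of x n e] assms by (metis d_def)
  from someI_ex[OF this] show "row_block x \<le> n" "x \<in> block_row e (row_block x)"
    by (simp_all add: row_block_def)
qed

lemma col_block: assumes "1 \<le> x" "x \<le> d" shows "col_block x \<le> n" "v x \<in> block_col n e (col_block x)"
proof -
  have "\<exists>k. k \<le> n \<and> v x \<in> block_col n e k"
    using block_col_cover[of "v x" n e] v_bounds[OF assms] by (metis d_def)
  from someI_ex[OF this] show "col_block x \<le> n" "v x \<in> block_col n e (col_block x)"
    by (simp_all add: col_block_def)
qed

text \<open>The pipes whose lace contains \<open>i\<close> and \<open>j\<close>, for \<open>i \<le> j\<close>.\<close>

definition laces where
  "laces i j = {x \<in> {1..d}. j \<le> row_block x \<and> col_block x \<le> i}"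

lemma card_laces: "i \<le> j \<Longrightarrow> j \<le> n \<Longrightarrow> card (laces i j) = r i j"
proof -
  assume ij: "i \<le> j" "j \<le> n"
  have "laces i j = {x \<in> {1..grid_size n e}. rows_above e j < x \<and> cols_left n e i < v x}"
    unfolding laces_def d_def[symmetric]
    using block_row_le_iff[OF row_block(2)] block_col_le_iff[OF col_block(2,1), of _ i] ij by auto
  then show ?thesis using zelevinsky_count[OF v ij] by simp
qed

lemma finite_laces: "finite (laces i j)" by (simp add: laces_def)

lemma laces_bounds: "x \<in> laces i j \<Longrightarrow> 1 \<le> x \<and> x \<le> d" by (simp add: laces_def)

lemma laces_Int: "i \<le> j \<Longrightarrow> laces i j = laces i i \<inter> laces j j"
  by (auto simp: laces_def)

lemma block_top_laces:
  assumes x: "1 \<le> x" "x \<le> d" and j: "j \<le> n" and p: "p < e j" "block_top n e j p \<in> pipe D x"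
  shows "x \<in> laces j j"
proof -
  have H: "Horiz (rows_above e j) (cols_left n e j + e j - p) \<in> pipe D x"
    using p by (simp add: block_top_def)
  have "rows_above e j < x" using pipe_pos_of_Horiz(2)[OF x H] .
  moreover have "cols_left n e j < v x"
    using pipe_Horiz_col_le[OF x H exit_edge[OF x]] p by simp
  ultimately show ?thesis
    using x block_row_le_iff[OF row_block(2)[OF x]] block_col_le_iff[OF col_block(2)[OF x] col_block(1)[OF x] j]
    by (simp add: laces_def)
qed

text \<open>The pipe must cross the line of the block top. East of the block it would be beyond the
  antidiagonal; west of it the crossings would carry it straight up to an exit left of block column
  \<open>j\<close>.\<close>

lemma laces_block_top:
  assumes x: "x \<in> laces j j" and j: "j \<le> n"
  obtains p where "p < e j" "block_top n e j p \<in> pipe D x"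
proof -
  have xd: "1 \<le> x" "x \<le> d" using x by (auto simp: laces_def)
  have r: "rows_above e j < x" and c: "cols_left n e j < v x"
    using x block_row_le_iff[OF row_block(2)[OF xd]] block_col_le_iff[OF col_block(2)[OF xd] col_block(1)[OF xd] j]
    by (auto simp: laces_def)
  obtain p where H: "Horiz (rows_above e j) p \<in> pipe D x"
    using pipe_crosses_line[OF xd exit_edge[OF xd] r] .
  have p1: "1 \<le> p" using pipe_pos_of_Horiz(1)[OF xd H] .
  have "rows_above e j + p \<le> d" using pipe_below_antidiagonal[OF pipe_dream xd(2) H] by simp
  then have p2: "p \<le> cols_left n e j + e j" using rows_cols[OF j, of e] by (simp add: d_def)
  have "cols_left n e j < p"
  proof (rule ccontr)
    assume "\<not> cols_left n e j < p"
    then have "Horiz 0 p \<in> pipe D x"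
      by (intro pipe_straight_up[OF H _ p1] northwest_crosses[OF j]) (use p1 in auto)
    then have "v x = p" using exit_unique xd by blast
    then show False using c \<open>\<not> cols_left n e j < p\<close> by simp
  qed
  then have "cols_left n e j + e j - p < e j" "block_top n e j (cols_left n e j + e j - p) \<in> pipe D x"
    using H p2 by (simp_all add: block_top_def)
  then show ?thesis using that by blast
qed

text \<open>Since indices count from the right, \<open>top_pos j x < top_pos j y\<close> puts
  \<open>x\<close> east of \<open>y\<close>; for \<open>x < y\<close> this is the swapped
  order.\<close>

definition top_pos where
  "top_pos j x = (SOME p. p < e j \<and> block_top n e j p \<in> pipe D x)"

lemma top_pos:
  assumes "x \<in> laces j j" "j \<le> n"
  shows "top_pos j x < e j" "block_top n e j (top_pos j x) \<in> pipe D x"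
proof -
  have "\<exists>p. p < e j \<and> block_top n e j p \<in> pipe D x" using laces_block_top[OF assms] by blast
  from someI_ex[OF this] show "top_pos j x < e j" "block_top n e j (top_pos j x) \<in> pipe D x"
    by (simp_all add: top_pos_def)
qed

lemma top_pos_unique:
  assumes x: "1 \<le> x" "x \<le> d" and j: "j \<le> n" and p: "p < e j" "block_top n e j p \<in> pipe D x"
  shows "p = top_pos j x"
proof -
  have t: "top_pos j x < e j" "block_top n e j (top_pos j x) \<in> pipe D x"
    using top_pos[OF block_top_laces[OF assms] j] by auto
  then have "cols_left n e j + e j - p = cols_left n e j + e j - top_pos j x"
    using pipe_Horiz_unique_col[OF x] p by (auto simp: block_top_def)
  then show ?thesis using p t by simp
qed

lemma top_pos_inj: "j \<le> n \<Longrightarrow> inj_on (top_pos j) (laces j j)"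
proof (rule inj_onI)
  fix x y assume *: "j \<le> n" "x \<in> laces j j" "y \<in> laces j j" "top_pos j x = top_pos j y"
  then show "x = y"
    using top_pos(2)[of x j] top_pos(2)[of y j] laces_bounds[OF *(2)] laces_bounds[OF *(3)]
      pipe_Horiz_unique_pipe[of x d y] by (auto simp: block_top_def)
qed

text \<open>Exactly \<open>r j j = e j\<close> pipes pass injectively through the \<open>e j\<close>
  edges of the block top, so every edge is used.\<close>

lemma top_pos_image: assumes "j \<le> n" shows "top_pos j ` laces j j = {..<e j}"
proof (rule card_subset_eq)
  show "top_pos j ` laces j j \<subseteq> {..<e j}" using top_pos(1) assms by auto
  show "card (top_pos j ` laces j j) = card {..<e j}"
    using card_image[OF top_pos_inj[OF assms]] card_laces[of j j] diagonal assms by simp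
qed simp

lemma swap_persists:
  assumes "x < y" "x \<in> laces j j" "y \<in> laces j j" "x \<in> laces i i" "y \<in> laces i i" "i \<le> j" "j \<le> n"
    and "top_pos j x < top_pos j y"
  shows "top_pos i x < top_pos i y"
proof -
  have in_n: "i \<le> n" using assms by simp
  have T: "block_top n e j (top_pos j x) \<in> pipe D x" "block_top n e j (top_pos j y) \<in> pipe D y"
    "block_top n e i (top_pos i x) \<in> pipe D x" "block_top n e i (top_pos i y) \<in> pipe D y"
    using top_pos(2) assms in_n by auto
  \<comment> \<open>This keeps the subtraction in \<open>block_top\<close> from truncating, so
    indices and columns are strictly oppositely ordered.\<close>
  have "top_pos j y < e j" using top_pos(1) assms by blast
  then have "cols_left n e i + e i - top_pos i y < cols_left n e i + e i - top_pos i x"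
    using line_swap_persists[OF pipe_dream red _ assms(1) _ T(1,2)[unfolded block_top_def] _
        T(3,4)[unfolded block_top_def] rows_above_mono[OF assms(6)]]
      laces_bounds[OF assms(2)] laces_bounds[OF assms(3)] assms(8) by simp
  then show ?thesis by simp
qed

lemma swap_exit:
  assumes "x < y" "x \<in> laces j j" "y \<in> laces j j" "j \<le> n" "top_pos j x < top_pos j y"
  shows "v y < v x"
proof -
  have T: "block_top n e j (top_pos j x) \<in> pipe D x" "block_top n e j (top_pos j y) \<in> pipe D y"
    "top_pos j y < e j"
    using top_pos assms by auto
  show ?thesis
    using line_swap_exit[OF pipe_dream red _ assms(1) _ T(1,2)[unfolded block_top_def] _ exit_edge exit_edge]
      laces_bounds[OF assms(2)] laces_bounds[OF assms(3)] assms(5) T(3) by simp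
qed

lemma order_exit:
  assumes "x \<in> laces j j" "y \<in> laces j j" "j \<le> n" "top_pos j y < top_pos j x" "v y < v x"
  shows "x < y"
proof -
  have T: "block_top n e j (top_pos j x) \<in> pipe D x" "block_top n e j (top_pos j y) \<in> pipe D y"
    "top_pos j x < e j"
    using top_pos assms by auto
  show ?thesis
    using line_order_exit[OF pipe_dream red _ _ _ _ T(1,2)[unfolded block_top_def] _ exit_edge exit_edge assms(5)]
      laces_bounds[OF assms(1)] laces_bounds[OF assms(2)] assms(4) T(3) by simp
qed

lemma row_block_less:
  assumes x: "1 \<le> x" "x \<le> d" and y: "1 \<le> y" "y \<le> d" and l: "row_block x < row_block y"
  shows "x < y"
  using rows_above_less[OF l, of e] row_block(2)[OF x] row_block(2)[OF y] by (simp add: block_row_def)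

lemma col_block_less:
  assumes x: "1 \<le> x" "x \<le> d" and y: "1 \<le> y" "y \<le> d" and l: "col_block x < col_block y"
  shows "v y < v x"
  using cols_left_less[OF l col_block(1)[OF y], of e] col_block(2)[OF x] col_block(2)[OF y]
  by (simp add: block_col_def)

text \<open>The ones of a block row, and those of a block column, run from northwest to southeast,
  so the two ones of an inversion share neither.\<close>

lemma inversion_blocks:
  assumes x: "1 \<le> x" "x \<le> d" and y: "1 \<le> y" "y \<le> d" and inv: "x < y" "v y < v x"
  shows "row_block x < row_block y" "col_block x < col_block y"
proof -
  have "row_block x \<noteq> row_block y"
  proof
    assume eq: "row_block x = row_block y"
    have "strict_mono_on (block_row e (row_block x)) v"
      using v row_block(1)[OF x] by (simp add: is_zelevinsky_perm_iff)
    then show False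
      using strict_mono_onD[of "block_row e (row_block x)" v x y]
        row_block(2)[OF x] row_block(2)[OF y] eq inv by simp
  qed
  moreover have "\<not> row_block y < row_block x" using row_block_less[OF y x] inv by auto
  ultimately show "row_block x < row_block y" by simp
  have "col_block x \<noteq> col_block y"
  proof
    assume eq: "col_block x = col_block y"
    have "strict_mono_on (block_col n e (col_block x)) (inv_into UNIV v)"
      using v col_block(1)[OF x] by (simp add: is_zelevinsky_perm_iff)
    then have "inv_into UNIV v (v y) < inv_into UNIV v (v x)"
      using strict_mono_onD[of "block_col n e (col_block x)" "inv_into UNIV v" "v y" "v x"]
        col_block(2)[OF x] col_block(2)[OF y] eq inv by simp
    then show False using permutes_inverses(2)[OF v_permutes] inv by simp
  qed
  moreover have "\<not> col_block y < col_block x" using col_block_less[OF y x] inv by auto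
  ultimately show "col_block x < col_block y" by simp
qed

section \<open>The lacing diagram and its rank array\<close>

definition lace_ones where
  "lace_ones i j = (\<lambda>x. (top_pos i x, top_pos j x)) ` laces i j"

lemma lace_ones_inj:
  assumes "i \<le> j" "j \<le> n"
  shows "inj_on fst (lace_ones i j)" "inj_on snd (lace_ones i j)"
  using top_pos_inj[of i] top_pos_inj[of j] laces_Int[OF assms(1)] assms
  by (auto simp: lace_ones_def inj_on_def)

lemma lace_ones_subset: "i \<le> j \<Longrightarrow> j \<le> n \<Longrightarrow> lace_ones i j \<subseteq> {..<e i} \<times> {..<e j}"
  using top_pos(1)[of _ i] top_pos(1)[of _ j] laces_Int[of i j] by (auto simp: lace_ones_def)

lemma card_lace_ones:
  assumes ij: "i \<le> j" "j \<le> n" shows "card (lace_ones i j) = r i j"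
proof -
  have "inj_on (\<lambda>x. (top_pos i x, top_pos j x)) (laces i j)"
    using top_pos_inj[of i] laces_Int[OF ij(1)] ij by (auto simp: inj_on_def)
  then show ?thesis unfolding lace_ones_def using card_image card_laces[OF ij] by metis
qed

text \<open>Defined for all pairs of blocks and not just consecutive ones, so that it can describe
  the products of the lacing diagram in closed form.\<close>

definition lace_mat :: "nat \<Rightarrow> nat \<Rightarrow> 'k::field mat" where
  "lace_mat i j = mat (e i) (e j) (\<lambda>z. if z \<in> lace_ones i j then 1 else 0)"

lemma rank_lace_mat: "i \<le> j \<Longrightarrow> j \<le> n \<Longrightarrow> vec_space.rank (e i) (lace_mat i j :: 'k::field mat) = r i j"
  unfolding lace_mat_def
  using rank_partial_permutation[OF lace_ones_subset lace_ones_inj] card_lace_ones by auto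

lemma lacing_of_eq: "j \<in> {1..n} \<Longrightarrow> lacing_of n e D j = (lace_mat (j - 1) j :: 'k::field mat)"
proof -
  assume j: "j \<in> {1..n}"
  have "(\<exists>x\<in>{1..d}. block_top n e (j - 1) p \<in> pipe D x \<and> block_top n e j q \<in> pipe D x) \<longleftrightarrow>
      (p, q) \<in> lace_ones (j - 1) j" if p: "p < e (j - 1)" and q: "q < e j" for p q
  proof
    assume "\<exists>x\<in>{1..d}. block_top n e (j - 1) p \<in> pipe D x \<and> block_top n e j q \<in> pipe D x"
    then obtain x where x: "1 \<le> x" "x \<le> d" "block_top n e (j - 1) p \<in> pipe D x" "block_top n e j q \<in> pipe D x"
      by auto
    have "x \<in> laces (j - 1) j"
      using block_top_laces[OF x(1,2) _ p x(3)] block_top_laces[OF x(1,2) _ q x(4)] j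
      by (auto simp: laces_def)
    moreover have "p = top_pos (j - 1) x" "q = top_pos j x"
      using top_pos_unique[OF x(1,2) _ p x(3)] top_pos_unique[OF x(1,2) _ q x(4)] j by auto
    ultimately show "(p, q) \<in> lace_ones (j - 1) j" by (auto simp: lace_ones_def)
  next
    assume "(p, q) \<in> lace_ones (j - 1) j"
    then obtain x where x: "x \<in> laces (j - 1) j" "p = top_pos (j - 1) x" "q = top_pos j x"
      by (auto simp: lace_ones_def)
    then have "x \<in> laces (j - 1) (j - 1)" "x \<in> laces j j" using laces_Int[of "j - 1" j] by auto
    moreover have "j - 1 \<le> n" "j \<le> n" using j by auto
    ultimately show "\<exists>x\<in>{1..d}. block_top n e (j - 1) p \<in> pipe D x \<and> block_top n e j q \<in> pipe D x"
      using top_pos(2)[of x "j - 1"] top_pos(2)[of x j] laces_bounds[OF x(1)] x(2,3)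
      by (intro bexI[of _ x]) simp_all
  qed
  then have "mat (e (j - 1)) (e j) (\<lambda>(p, q). if \<exists>x\<in>{1..d}. block_top n e (j - 1) p \<in> pipe D x \<and>
      block_top n e j q \<in> pipe D x then 1 else 0) = (lace_mat (j - 1) j :: 'k mat)"
    unfolding lace_mat_def by (intro eq_matI) auto
  then show ?thesis using j by (simp add: lacing_of_def d_def)
qed

lemma lace_mat_refl: assumes "j \<le> n" shows "lace_mat j j = (1\<^sub>m (e j) :: 'k::field mat)"
proof -
  have "(p, q) \<in> lace_ones j j \<longleftrightarrow> p = q" if "p < e j" for p q
  proof -
    have "p \<in> top_pos j ` laces j j" using that top_pos_image[OF assms] by simp
    then show ?thesis by (auto simp: lace_ones_def)
  qed
  then show ?thesis by (intro eq_matI) (auto simp: lace_mat_def)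
qed

text \<open>A lace is an interval, so a pipe that meets the tops of blocks \<open>i\<close> and
  \<open>j\<close> also meets that of \<open>Suc i\<close>. Each top edge determines its pipe, so at
  most one term of the matrix product is nonzero.\<close>

lemma lace_mat_mult:
  assumes ij: "i < j" "j \<le> n"
  shows "lace_mat i (Suc i) * lace_mat (Suc i) j = (lace_mat i j :: 'k::field mat)"
proof (rule eq_matI)
  fix p s assume "p < dim_row (lace_mat i j :: 'k mat)" "s < dim_col (lace_mat i j :: 'k mat)"
  then have p: "p < e i" and s: "s < e j" by (auto simp: lace_mat_def)
  let ?t = "\<lambda>q. if (p, q) \<in> lace_ones i (Suc i) \<and> (q, s) \<in> lace_ones (Suc i) j then 1 else 0 :: 'k"
  have L: "laces i j = laces i (Suc i) \<inter> laces (Suc i) j" using ij by (auto simp: laces_def)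
  have sum: "(lace_mat i (Suc i) * lace_mat (Suc i) j :: 'k mat) $$ (p, s) = (\<Sum>q<e (Suc i). ?t q)"
    using p s by (auto simp: lace_mat_def scalar_prod_def lessThan_atLeast0 intro!: sum.cong)
  have char: "q = top_pos (Suc i) x" "(p, s) \<in> lace_ones i j"
    if x: "x \<in> laces i (Suc i)" "p = top_pos i x" and q: "(p, q) \<in> lace_ones i (Suc i)" "(q, s) \<in> lace_ones (Suc i) j"
    for x q
  proof -
    obtain x' where x': "x' \<in> laces i (Suc i)" "p = top_pos i x'" "q = top_pos (Suc i) x'"
      using q by (auto simp: lace_ones_def)
    have "x' = x" using top_pos_inj[of i] x x' ij laces_Int[of i "Suc i"] by (auto simp: inj_on_def)
    then show qx: "q = top_pos (Suc i) x" using x' by simp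
    obtain y where y: "y \<in> laces (Suc i) j" "q = top_pos (Suc i) y" "s = top_pos j y"
      using q by (auto simp: lace_ones_def)
    have "y = x"
      using top_pos_inj[of "Suc i"] x y qx ij laces_Int[of i "Suc i"] laces_Int[of "Suc i" j]
      by (auto simp: inj_on_def)
    then show "(p, s) \<in> lace_ones i j" using x y L by (auto simp: lace_ones_def)
  qed
  show "(lace_mat i (Suc i) * lace_mat (Suc i) j :: 'k mat) $$ (p, s) = (lace_mat i j :: 'k mat) $$ (p, s)"
  proof (cases "(p, s) \<in> lace_ones i j")
    case True
    then obtain x where x: "x \<in> laces i j" "p = top_pos i x" "s = top_pos j x" by (auto simp: lace_ones_def)
    define q where "q = top_pos (Suc i) x"
    have xs: "x \<in> laces i (Suc i)" "x \<in> laces (Suc i) j" using x L by auto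
    have "q < e (Suc i)"
      using top_pos(1)[of x "Suc i"] xs laces_Int[of i "Suc i"] ij by (simp add: q_def)
    moreover have "?t q = 1" using x xs by (auto simp: lace_ones_def q_def)
    moreover have "?t q' = 0" if "q' \<noteq> q" for q' using char(1)[OF xs(1) x(2), of q'] that by (auto simp: q_def)
    ultimately have "(\<Sum>q<e (Suc i). ?t q) = 1"
      using sum.remove[of "{..<e (Suc i)}" q ?t] by (simp add: sum.neutral)
    then show ?thesis using sum True p s by (simp add: lace_mat_def)
  next
    case False
    have "?t q = 0" for q using char(2)[of _ q] False by (auto simp: lace_ones_def)
    then have "(\<Sum>q<e (Suc i). ?t q) = 0" by simp
    then show ?thesis using sum False p s by (simp add: lace_mat_def)
  qed
qed (auto simp: lace_mat_def)

lemma path_product_lacing: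
  assumes "i \<le> j" "j \<le> n"
  shows "path_product e (lacing_of n e D) i j = (lace_mat i j :: 'k::field mat)"
  using assms(1)
proof (induction i rule: inc_induct)
  case base
  then show ?case by (simp add: path_product_refl lace_mat_refl assms(2))
next
  case (step i)
  have "lacing_of n e D (Suc i) = (lace_mat i (Suc i) :: 'k mat)"
    using lacing_of_eq[of "Suc i"] step assms by simp
  then show ?case using step assms by (simp add: path_product_Suc_left lace_mat_mult)
qed

lemma lacing_has_rank_array: "has_rank_array n e r (lacing_of n e D :: nat \<Rightarrow> 'k::field mat)"
  by (auto simp: has_rank_array_def diagonal path_product_lacing rank_lace_mat)

lemma lacing_in_lacing_diagrams: "(lacing_of n e D :: nat \<Rightarrow> 'k::field mat) \<in> lacing_diagrams n e"
proof -
  have Hom: "(lacing_of n e D :: nat \<Rightarrow> 'k mat) \<in> Hom n e"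
    by (auto simp: Hom_def lacing_of_def)
  have "partial_perm (lacing_of n e D j :: 'k mat)" if j: "j \<in> {1..n}" for j
  proof -
    have inj: "inj_on fst (lace_ones (j - 1) j)" "inj_on snd (lace_ones (j - 1) j)"
      using lace_ones_inj[of "j - 1" j] j by auto
    have "card {q. q < e j \<and> (p, q) \<in> lace_ones (j - 1) j} \<le> 1" for p
      unfolding One_nat_def using inj(1)[unfolded inj_on_def]
      by (subst card_le_Suc0_iff_eq) fastforce+
    moreover have "card {p. p < e (j - 1) \<and> (p, q) \<in> lace_ones (j - 1) j} \<le> 1" for q
      unfolding One_nat_def using inj(2)[unfolded inj_on_def]
      by (subst card_le_Suc0_iff_eq) fastforce+
    moreover have "{q. q < e j \<and> lace_mat (j - 1) j $$ (p, q) = (1 :: 'k)} = {q. q < e j \<and> (p, q) \<in> lace_ones (j - 1) j}"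
      if "p < e (j - 1)" for p
      using that by (auto simp: lace_mat_def split: if_splits)
    moreover have "{p. p < e (j - 1) \<and> lace_mat (j - 1) j $$ (p, q) = (1 :: 'k)} = {p. p < e (j - 1) \<and> (p, q) \<in> lace_ones (j - 1) j}"
      if "q < e j" for q
      using that by (auto simp: lace_mat_def split: if_splits)
    moreover have "lace_mat (j - 1) j $$ (p, q) \<in> {0, 1 :: 'k}" if "p < e (j - 1)" "q < e j" for p q
      using that by (auto simp: lace_mat_def)
    moreover have "dim_row (lace_mat (j - 1) j :: 'k mat) = e (j - 1)" "dim_col (lace_mat (j - 1) j :: 'k mat) = e j"
      by (simp_all add: lace_mat_def)
    ultimately show ?thesis unfolding lacing_of_eq[OF j] partial_perm_def by simp
  qed
  then show ?thesis using Hom by (simp add: lacing_diagrams_def)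
qed

text \<open>A box \<open>(p, q)\<close> of the diagram of the \<open>j\<close>-th partial permutation is the pair of the pipes
  through the \<open>p\<close>-th top edge of block \<open>j - 1\<close> and the \<open>q\<close>-th top edge of block \<open>j\<close>.\<close>

definition diagram_pairs where
  "diagram_pairs j = {(x, y). x \<in> laces (j - 1) (j - 1) \<and> y \<in> laces j j \<and>
     (j \<le> row_block x \<longrightarrow> top_pos j y < top_pos j x) \<and>
     (col_block y \<le> j - 1 \<longrightarrow> top_pos (j - 1) x < top_pos (j - 1) y)}"

text \<open>Row \<open>p\<close> contains a one exactly if its pipe \<open>x\<close> goes on to
  block \<open>j\<close>, and column \<open>q\<close> exactly if its pipe \<open>y\<close> comes
  from block \<open>j - 1\<close>. The two conditions on a diagram box thus become the two guarded
  inequalities of \<open>diagram_pairs\<close>.\<close>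

lemma card_rothe_diagram:
  assumes j: "1 \<le> j" "j \<le> n"
  shows "card (rothe_diagram (e (j - 1)) (e j) (lace_ones (j - 1) j)) = card (diagram_pairs j)"
proof -
  let ?f = "map_prod (top_pos (j - 1)) (top_pos j)"
  let ?R = "rothe_diagram (e (j - 1)) (e j) (lace_ones (j - 1) j)"
  have inj: "inj_on ?f (laces (j - 1) (j - 1) \<times> laces j j)"
    using map_prod_inj_on[OF top_pos_inj[of "j - 1"] top_pos_inj[of j]] j by simp
  have iff: "?f (x, y) \<in> ?R \<longleftrightarrow> (x, y) \<in> diagram_pairs j"
    if x: "x \<in> laces (j - 1) (j - 1)" and y: "y \<in> laces j j" for x y
  proof -
    have tx: "top_pos (j - 1) x < e (j - 1)" and ty: "top_pos j y < e j"
      using top_pos(1)[OF x] top_pos(1)[OF y] j by auto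
    have injs: "inj_on (top_pos (j - 1)) (laces (j - 1) (j - 1))" "inj_on (top_pos j) (laces j j)"
      using top_pos_inj j by auto
    have L: "z \<in> laces (j - 1) j \<longleftrightarrow> z \<in> laces (j - 1) (j - 1) \<and> z \<in> laces j j" for z
      using laces_Int[of "j - 1" j] by auto
    have 1: "(top_pos (j - 1) x, k) \<in> lace_ones (j - 1) j \<longleftrightarrow> j \<le> row_block x \<and> k = top_pos j x" for k
    proof -
      have "(top_pos (j - 1) x, k) \<in> lace_ones (j - 1) j \<longleftrightarrow> x \<in> laces j j \<and> k = top_pos j x"
        using x injs(1) L by (auto simp: lace_ones_def inj_on_def)
      moreover have "x \<in> laces j j \<longleftrightarrow> j \<le> row_block x" using x by (auto simp: laces_def)
      ultimately show ?thesis by simp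
    qed
    have 2: "(i, top_pos j y) \<in> lace_ones (j - 1) j \<longleftrightarrow> col_block y \<le> j - 1 \<and> i = top_pos (j - 1) y" for i
    proof -
      have "(i, top_pos j y) \<in> lace_ones (j - 1) j \<longleftrightarrow> y \<in> laces (j - 1) (j - 1) \<and> i = top_pos (j - 1) y"
        using y injs(2) L by (auto simp: lace_ones_def inj_on_def)
      moreover have "y \<in> laces (j - 1) (j - 1) \<longleftrightarrow> col_block y \<le> j - 1" using y by (auto simp: laces_def)
      ultimately show ?thesis by simp
    qed
    have "?f (x, y) \<in> ?R \<longleftrightarrow>
        (\<forall>k\<le>top_pos j y. (top_pos (j - 1) x, k) \<notin> lace_ones (j - 1) j) \<and>
        (\<forall>i\<le>top_pos (j - 1) x. (i, top_pos j y) \<notin> lace_ones (j - 1) j)"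
      using tx ty by (simp add: rothe_diagram_def)
    also have "\<dots> \<longleftrightarrow> (x, y) \<in> diagram_pairs j"
      unfolding 1 2 using x y by (auto simp: diagram_pairs_def not_le[symmetric])
    finally show ?thesis .
  qed
  have "?R = ?f ` diagram_pairs j"
  proof (intro equalityI subsetI)
    fix z assume z: "z \<in> ?R"
    obtain p q where pq: "z = (p, q)" by (cases z)
    then have "p \<in> top_pos (j - 1) ` laces (j - 1) (j - 1)" "q \<in> top_pos j ` laces j j"
      using z top_pos_image j by (auto simp: rothe_diagram_def)
    then obtain x y where "x \<in> laces (j - 1) (j - 1)" "y \<in> laces j j" "z = ?f (x, y)" using pq by auto
    then show "z \<in> ?f ` diagram_pairs j" using iff z by blast
  next
    fix z assume "z \<in> ?f ` diagram_pairs j"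
    then show "z \<in> ?R" using iff by (auto simp: diagram_pairs_def)
  qed
  moreover have "inj_on ?f (diagram_pairs j)"
    by (rule inj_on_subset[OF inj]) (auto simp: diagram_pairs_def)
  ultimately show ?thesis by (simp add: card_image)
qed

text \<open>The inequalities exclude empty laces. In terms of quiver representations, these are the
  pairs of interval modules with a non-split extension in one of the two directions.\<close>

definition crossing_laces where
  "crossing_laces = {(x, y). x \<in> {1..d} \<and> y \<in> {1..d} \<and>
     col_block x < col_block y \<and> col_block y \<le> Suc (row_block x) \<and> row_block x < row_block y}"

text \<open>The pair is shown to be an inversion of \<open>v\<close>. Where an order at a block top
  is missing, blocks replace it: if \<open>x\<close> ends at block \<open>j - 1\<close>, it starts
  above \<open>y\<close>; if \<open>y\<close> does not reach block \<open>j - 1\<close>, it exits to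
  the left of \<open>x\<close>.\<close>

lemma diagram_pairs_crossing:
  assumes j: "1 \<le> j" "j \<le> n" and xy: "(x, y) \<in> diagram_pairs j"
  shows "(x, y) \<in> crossing_laces"
proof -
  have x: "x \<in> laces (j - 1) (j - 1)" and y: "y \<in> laces j j"
    and right: "j \<le> row_block x \<Longrightarrow> top_pos j y < top_pos j x"
    and left: "col_block y \<le> j - 1 \<Longrightarrow> top_pos (j - 1) x < top_pos (j - 1) y"
    using xy by (auto simp: diagram_pairs_def)
  have xd: "1 \<le> x" "x \<le> d" and yd: "1 \<le> y" "y \<le> d" using laces_bounds x y by blast+
  have bx: "j - 1 \<le> row_block x" "col_block x \<le> j - 1" and by': "j \<le> row_block y" "col_block y \<le> j"
    using x y by (auto simp: laces_def)
  have xj: "x \<in> laces j j" if "j \<le> row_block x" using that x by (auto simp: laces_def)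
  have yj: "y \<in> laces (j - 1) (j - 1)" if "col_block y \<le> j - 1" using that y by (auto simp: laces_def)
  have "x < y \<and> v y < v x"
  proof (cases "j \<le> row_block x")
    case rx: True
    show ?thesis
    proof (cases "col_block y \<le> j - 1")
      case cy: True
      \<comment> \<open>For \<open>y < x\<close> the order at block \<open>j\<close> would be the
        swapped one and would persist to block \<open>j - 1\<close>, against
        \<open>left\<close>.\<close>
      have "\<not> y < x"
        using swap_persists[of y x j "j - 1"] x y xj[OF rx] yj[OF cy] j right[OF rx] left[OF cy] by auto
      moreover have "x \<noteq> y" using right[OF rx] by auto
      ultimately have "x < y" by simp
      then show ?thesis using swap_exit[of x y "j - 1"] x yj[OF cy] j left[OF cy] by simp
    next
      case False
      then have "col_block x < col_block y" using bx by simp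
      then have "v y < v x" using col_block_less[OF xd yd] by simp
      then show ?thesis using order_exit[OF xj[OF rx] y j(2) right[OF rx]] by simp
    qed
  next
    case False
    then have "row_block x < row_block y" using by' by simp
    then have lt: "x < y" using row_block_less[OF xd yd] by simp
    show ?thesis
    proof (cases "col_block y \<le> j - 1")
      case True
      then show ?thesis using swap_exit[of x y "j - 1"] x yj j left lt by simp
    next
      case False
      then have "col_block x < col_block y" using bx by simp
      then show ?thesis using col_block_less[OF xd yd] lt by simp
    qed
  qed
  then have "row_block x < row_block y" "col_block x < col_block y"
    using inversion_blocks[OF xd yd] by auto
  moreover have "col_block y \<le> Suc (row_block x)" using bx by' by simp
  ultimately show ?thesis using xd yd by (simp add: crossing_laces_def)
qed

text \<open>The witness \<open>j\<close> is the least index at which both the lace of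
  \<open>y\<close> has begun and \<open>y\<close> is still east of \<open>x\<close>; below it the
  order is already swapped. At \<open>Suc (row_block x)\<close> the condition on the order is
  vacuous, so such an index exists.\<close>

lemma crossing_diagram_pairs:
  assumes xy: "(x, y) \<in> crossing_laces"
  obtains j where "1 \<le> j" "j \<le> n" "(x, y) \<in> diagram_pairs j"
proof -
  have xd: "1 \<le> x" "x \<le> d" and yd: "1 \<le> y" "y \<le> d"
    and C: "col_block x < col_block y" "col_block y \<le> Suc (row_block x)" "row_block x < row_block y"
    using xy by (auto simp: crossing_laces_def)
  define P where "P i \<longleftrightarrow> col_block y \<le> i \<and> (i \<le> row_block x \<longrightarrow> top_pos i y < top_pos i x)" for i
  define j where "j = (LEAST i. P i)"
  have P: "P (Suc (row_block x))" using C by (simp add: P_def)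
  have Pj: "P j" and jle: "j \<le> Suc (row_block x)"
    unfolding j_def using LeastI[of P, OF P] Least_le[of P, OF P] by auto
  have cy: "col_block y \<le> j" using Pj by (simp add: P_def)
  have j: "1 \<le> j" "j \<le> n" using cy C jle row_block(1)[OF yd] by auto
  have x: "x \<in> laces (j - 1) (j - 1)" and y: "y \<in> laces j j"
    using xd yd C cy jle by (auto simp: laces_def)
  have "top_pos (j - 1) x < top_pos (j - 1) y" if c: "col_block y \<le> j - 1"
  proof -
    have "\<not> P (j - 1)" using not_less_Least[of "j - 1" P] j by (simp add: j_def[symmetric])
    then have "\<not> top_pos (j - 1) y < top_pos (j - 1) x" using c by (simp add: P_def)
    moreover have "y \<in> laces (j - 1) (j - 1)" using y c by (auto simp: laces_def)
    then have "top_pos (j - 1) x \<noteq> top_pos (j - 1) y"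
      using inj_onD[OF top_pos_inj[of "j - 1"], of x y] x j C(1) by fastforce
    ultimately show ?thesis by simp
  qed
  then have "(x, y) \<in> diagram_pairs j" using x y Pj by (simp add: diagram_pairs_def P_def)
  then show ?thesis using that j by blast
qed

text \<open>The first pair says that the order at block \<open>j\<close> is the original one, the
  second that it is swapped at block \<open>j' - 1\<close>. As \<open>j \<le> j' - 1\<close>, the
  swap would have to persist to block \<open>j\<close>.\<close>

lemma diagram_pairs_unique:
  assumes "1 \<le> j" "j < j'" "j' \<le> n" "(x, y) \<in> diagram_pairs j" "(x, y) \<in> diagram_pairs j'"
  shows False
proof -
  have C: "(x, y) \<in> crossing_laces" using diagram_pairs_crossing assms by simp
  then have xd: "1 \<le> x" "x \<le> d" and yd: "1 \<le> y" "y \<le> d" and "row_block x < row_block y"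
    by (auto simp: crossing_laces_def)
  then have xy: "x < y" using row_block_less by blast
  have b: "col_block x \<le> j - 1" "j' - 1 \<le> row_block x" "col_block y \<le> j" "j' \<le> row_block y"
    using assms(4,5) by (simp_all add: diagram_pairs_def laces_def)
  have mem: "x \<in> laces j j" "y \<in> laces j j" "x \<in> laces (j' - 1) (j' - 1)" "y \<in> laces (j' - 1) (j' - 1)"
    using xd yd b assms(1,2) by (auto simp: laces_def)
  have "top_pos j y < top_pos j x" "top_pos (j' - 1) x < top_pos (j' - 1) y"
    using assms(2,4,5) b by (auto simp: diagram_pairs_def)
  then show False
    using swap_persists[OF xy mem(3,4,1,2)] assms by fastforce
qed

lemma lacing_length_eq: "lacing_length n (lacing_of n e D :: nat \<Rightarrow> 'k::field mat) = card crossing_laces"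
proof -
  have len: "perm_length (completion (lacing_of n e D j :: 'k mat)) = card (diagram_pairs j)"
    if j: "j \<in> {1..n}" for j
  proof -
    have "lace_ones (j - 1) j = {(i, k). i < e (j - 1) \<and> k < e j \<and> (lace_mat (j - 1) j :: 'k mat) $$ (i, k) = 1}"
      using lace_ones_subset[of "j - 1" j] j by (auto simp: lace_mat_def split: if_splits)
    then have "perm_length (completion (lace_mat (j - 1) j :: 'k mat)) =
        card (rothe_diagram (e (j - 1)) (e j) (lace_ones (j - 1) j))"
      using lace_ones_inj[of "j - 1" j] j
      by (intro perm_length_completion) (auto simp: lace_mat_def)
    then show ?thesis using card_rothe_diagram[of j] lacing_of_eq[OF j, where 'k = 'k] j by simp
  qed
  have fin: "finite (diagram_pairs j)" for j
    by (rule finite_subset[of _ "laces (j - 1) (j - 1) \<times> laces j j"])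
      (auto simp: diagram_pairs_def finite_laces)
  have "(\<Union>j\<in>{1..n}. diagram_pairs j) = crossing_laces"
  proof (intro equalityI subsetI)
    fix z assume z: "z \<in> crossing_laces"
    obtain x y where xy: "z = (x, y)" by (cases z)
    obtain j where "1 \<le> j" "j \<le> n" "(x, y) \<in> diagram_pairs j"
      using crossing_diagram_pairs z xy by blast
    then show "z \<in> (\<Union>j\<in>{1..n}. diagram_pairs j)" using xy by auto
  next
    fix z assume "z \<in> (\<Union>j\<in>{1..n}. diagram_pairs j)"
    then show "z \<in> crossing_laces" using diagram_pairs_crossing by (cases z) auto
  qed
  moreover have "card (\<Union>j\<in>{1..n}. diagram_pairs j) = (\<Sum>j\<in>{1..n}. card (diagram_pairs j))"
  proof (rule card_UN_disjoint)
    show "\<forall>i\<in>{1..n}. \<forall>j\<in>{1..n}. i \<noteq> j \<longrightarrow> diagram_pairs i \<inter> diagram_pairs j = {}"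
      using diagram_pairs_unique by (auto simp: linorder_neq_iff) blast+
  qed (simp_all add: fin)
  ultimately show ?thesis using len by (simp add: lacing_length_def)
qed

text \<open>The first factor of the summand for \<open>(i, j)\<close> counts the laces ending at
  \<open>j - 1\<close> that begin at \<open>i\<close> or before, the second those beginning at
  \<open>i + 1\<close> that reach \<open>j\<close>. So a crossing pair occurs in one summand only,
  with \<open>i = col_block y - 1\<close> and \<open>j = Suc (row_block x)\<close>.\<close>

lemma card_crossing_laces: "int (card crossing_laces) = quiver_codim n r"
proof -
  let ?I = "{(i, j). i < j \<and> j \<le> n}"
  define S where "S = (\<lambda>(i, j). (laces i (j - 1) - laces i j) \<times> (laces (i + 1) j - laces i j))"
  have finI: "finite ?I" by (rule finite_subset[of _ "{..n} \<times> {..n}"]) auto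
  have cS: "int (card (S (i, j))) = (int (r i (j - 1)) - int (r i j)) * (int (r (i + 1) j) - int (r i j))"
    if ij: "i < j" "j \<le> n" for i j
  proof -
    have sub: "laces i j \<subseteq> laces i (j - 1)" "laces i j \<subseteq> laces (i + 1) j" by (auto simp: laces_def)
    have "int (card (laces i (j - 1) - laces i j)) = int (r i (j - 1)) - int (r i j)"
      using card_Diff_subset[OF finite_laces sub(1)] card_mono[OF finite_laces sub(1)]
        card_laces[of i "j - 1"] card_laces[of i j] ij by simp
    moreover have "int (card (laces (i + 1) j - laces i j)) = int (r (i + 1) j) - int (r i j)"
      using card_Diff_subset[OF finite_laces sub(2)] card_mono[OF finite_laces sub(2)]
        card_laces[of "i + 1" j] card_laces[of i j] ij by simp
    ultimately show ?thesis by (simp add: S_def card_cartesian_product)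
  qed
  have memS: "(x, y) \<in> S (i, j) \<longleftrightarrow> x \<in> {1..d} \<and> y \<in> {1..d} \<and> col_block x \<le> i \<and> j = Suc (row_block x) \<and>
      col_block y = Suc i \<and> j \<le> row_block y" if "i < j" for x y i j
    using that by (auto simp: S_def laces_def)
  have "crossing_laces = (\<Union>z\<in>?I. S z)"
  proof (intro equalityI subsetI)
    fix z assume z: "z \<in> crossing_laces"
    obtain x y where xy: "z = (x, y)" by (cases z)
    then have C: "x \<in> {1..d}" "y \<in> {1..d}" "col_block x < col_block y"
      "col_block y \<le> Suc (row_block x)" "row_block x < row_block y"
      using z by (auto simp: crossing_laces_def)
    define i j where "i = col_block y - 1" and "j = Suc (row_block x)"
    have "i < j" "j \<le> n" using C row_block(1)[of y] by (auto simp: i_def j_def)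
    moreover from this have "z \<in> S (i, j)" using memS C xy by (auto simp: i_def j_def)
    ultimately show "z \<in> (\<Union>z\<in>?I. S z)" by blast
  next
    fix z assume "z \<in> (\<Union>z\<in>?I. S z)"
    then obtain i j where ij: "i < j" "j \<le> n" "z \<in> S (i, j)" by auto
    obtain x y where "z = (x, y)" by (cases z)
    then show "z \<in> crossing_laces" using memS[OF ij(1), of x y] ij by (auto simp: crossing_laces_def)
  qed
  moreover have "card (\<Union>z\<in>?I. S z) = (\<Sum>z\<in>?I. card (S z))"
  proof (rule card_UN_disjoint[OF finI])
    show "\<forall>z\<in>?I. finite (S z)" by (auto simp: S_def finite_laces)
    show "\<forall>z\<in>?I. \<forall>z'\<in>?I. z \<noteq> z' \<longrightarrow> S z \<inter> S z' = {}"
    proof (intro ballI impI)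
      fix z z' assume z: "z \<in> ?I" "z' \<in> ?I" "z \<noteq> z'"
      obtain i j i' j' where zz: "z = (i, j)" "z' = (i', j')" by (cases z; cases z') auto
      have "a \<notin> S z'" if "a \<in> S z" for a
        using that z zz memS[of i j] memS[of i' j'] by (cases a) auto
      then show "S z \<inter> S z' = {}" by blast
    qed
  qed
  moreover have "(\<Sum>z\<in>?I. int (card (S z))) = quiver_codim n r"
    unfolding quiver_codim_def by (intro sum.cong) (auto simp: cS)
  ultimately show ?thesis by simp
qed

lemma lacing_in_W: "(lacing_of n e D :: nat \<Rightarrow> 'k::field mat) \<in> W n e r"
  by (simp add: W_def lacing_in_lacing_diagrams lacing_has_rank_array lacing_length_eq card_crossing_laces)

end

theorem theorem10:
  fixes n :: nat and e :: "nat \<Rightarrow> nat" and r :: "nat \<Rightarrow> nat \<Rightarrow> nat" and D :: "(nat \<times> nat) set"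
  assumes "n \<ge> 1"
    and "can_occur TYPE('k::field) n e r"
    and "D \<in> RP (grid_size n e) (zelevinsky_perm n e r)"
  shows "(lacing_of n e D :: nat \<Rightarrow> 'k mat) \<in> W n e r"
proof -
  interpret zelevinsky_pipe_dream n e r "zelevinsky_perm n e r" D
  proof
    show "is_zelevinsky_perm n e r (zelevinsky_perm n e r)"
      using is_zelevinsky_perm_zelevinsky_perm[OF assms(2)] .
    show "r i i = e i" if "i \<le> n" for i
      using assms(2) that by (auto simp: can_occur_def has_rank_array_def)
  qed (rule assms(3))
  show ?thesis by (rule lacing_in_W)
qed

end
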